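(* Let $n\ge 0$ and $0\le k\le n+1$ be integers and let $\mu$ be a locally $k$-uniform measure in $\mathbb{R}^{n+1}$. Assume there is a point $z_0\in\operatorname{supp}\mu$ such that the mean curvature vector of $\operatorname{supp}\mu$ vanishes at $z_0$ (in particular, it is assumed to be well defined there, i.e. $\operatorname{supp}\mu$ is a $k$-dimensional manifold of class $C^2$ in a neighborhood of $z_0$). Then the connected component of $\operatorname{supp}\mu$ containing $z_0$ is a $k$-plane.
   Context: $B(x,r)$ denotes the open Euclidean ball in $\mathbb{R}^{n+1}$ of center $x$ and radius $r$. A Radon measure $\mu$ on $\mathbb{R}^{n+1}$ is locally $k$-uniform if $\mu(B(x,r))=w_k r^k$ whenever $x\in\operatorname{supp}\mu$ and $0<r\le 1$, where $w_k=\mathcal{H}^k(B^k(0,1))$ is the $k$-dimensional measure of the unit ball $B^k(0,1)$ of $\mathbb{R}^k$. A $k$-plane is a $k$-dimensional affine subspace of $\mathbb{R}^{n+1}$. The mean curvature vector of a $k$-dimensional $C^2$ submanifold $\mathcal{M}$ of $\mathbb{R}^{n+1}$ at $z\in\mathcal{M}$ is $H_{\mathcal{M}}(z)=\frac1k$ times the trace (with respect to the induced metric) of the normal-space-valued second fundamental form $(u,v)\mapsto \Pi_{N_{\mathcal{M}}(z)}(u\cdot\nabla v)$, where $\Pi_{N_{\mathcal{M}}(z)}$ is the orthogonal projection onto the normal space of $\mathcal{M}$ at $z$. In coordinates: if, after a translation and rotation, $z=0$ and near $0$ the set $\mathcal{M}$ is the graph $\{(x',\varphi(x'))\}$ of a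 $C^2$ function $\varphi=(\varphi_{k+1},\dots,\varphi_{n+1}):\mathbb{R}^k\to\mathbb{R}^{n+1-k}$ with $\varphi(0)=0$ and $\nabla\varphi_j(0)=0$ for all $j$, then $H_{\mathcal{M}}(0)=\frac1k(0,\Delta\varphi(0))$, where $\Delta\varphi=(\Delta\varphi_{k+1},\dots,\Delta\varphi_{n+1})$. *)

theory Defs
  imports "HOL-Analysis.Analysis"
begin

section \<open>Locally uniform measures\<close>

definition radon_measure :: "'a::euclidean_space measure \<Rightarrow> bool" where
  "radon_measure \<mu> \<longleftrightarrow>
     sets \<mu> = sets borel \<and>
     (\<forall>K. compact K \<longrightarrow> emeasure \<mu> K < \<infinity>) \<and>
     (\<forall>U. open U \<longrightarrow> emeasure \<mu> U = (SUP K\<in>{K. compact K \<and> K \<subseteq> U}. emeasure \<mu> K)) \<and>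
     (\<forall>A\<in>sets borel. emeasure \<mu> A = (INF U\<in>{U. open U \<and> A \<subseteq> U}. emeasure \<mu> U))"

definition msupport :: "'a::metric_space measure \<Rightarrow> 'a set" where
  "msupport \<mu> = {x. \<forall>r>0. emeasure \<mu> (ball x r) > 0}"

text \<open>
  The constant \<open>unit_ball_vol k\<close> is the Lebesgue measure of the unit ball of a
  \<open>k\<close>-dimensional Euclidean space (\<open>content_ball\<close>), which is its (normalised)
  \<open>k\<close>-dimensional Hausdorff measure; \<open>unit_ball_vol 0 = 1\<close>.
\<close>

definition locally_uniform :: "nat \<Rightarrow> 'a::euclidean_space measure \<Rightarrow> bool" where
  "locally_uniform k \<mu> \<longleftrightarrow>
     radon_measure \<mu> \<and>
     (\<forall>x\<in>msupport \<mu>. \<forall>r. 0 < r \<and> r \<le> 1 \<longrightarrow>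
        emeasure \<mu> (ball x r) = ennreal (unit_ball_vol (real k) * r ^ k))"

definition k_plane :: "nat \<Rightarrow> 'a::euclidean_space set \<Rightarrow> bool" where
  "k_plane k P \<longleftrightarrow> affine P \<and> aff_dim P = int k"


section \<open>Submanifolds of class \<open>C\<^sup>2\<close>\<close>

definition C1_on :: "'a::real_normed_vector set \<Rightarrow> ('a \<Rightarrow> 'b::real_normed_vector) \<Rightarrow> bool" where
  "C1_on S f \<longleftrightarrow>
     (\<exists>f'. (\<forall>x\<in>S. (f has_derivative blinfun_apply (f' x)) (at x)) \<and> continuous_on S f')"

definition C2_on :: "'a::real_normed_vector set \<Rightarrow> ('a \<Rightarrow> 'b::real_normed_vector) \<Rightarrow> bool" where
  "C2_on S f \<longleftrightarrow>
     (\<exists>f'. (\<forall>x\<in>S. (f has_derivative blinfun_apply (f' x)) (at x)) \<and> C1_on S f')"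

text \<open>
  Near \<open>z\<close> the set \<open>M\<close> is the graph of a \<open>C\<^sup>2\<close> map from a relatively open subset of
  a \<open>k\<close>-dimensional linear subspace \<open>T\<close> into the orthogonal complement of \<open>T\<close>.
  The map is given on an open subset of the whole space, which is no restriction,
  since it can be precomposed with the projection onto \<open>T\<close>; only its values on \<open>T\<close> matter.
\<close>

definition C2_submanifold_near :: "nat \<Rightarrow> 'a::euclidean_space set \<Rightarrow> 'a \<Rightarrow> bool" where
  "C2_submanifold_near k M z \<longleftrightarrow>
     z \<in> M \<and>
     (\<exists>T U W \<phi>. subspace T \<and> dim T = k \<and> open U \<and> z \<in> U \<and> open W \<and>
        C2_on W \<phi> \<and> (\<forall>x\<in>T \<inter> W. \<phi> x \<in> T\<^sup>\<bottom>) \<and>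
        M \<inter> U = {x + \<phi> x | x. x \<in> T \<inter> W})"


section \<open>The mean curvature vector\<close>

definition tangent_space :: "'a::euclidean_space set \<Rightarrow> 'a \<Rightarrow> 'a set" where
  "tangent_space M z =
     {v. \<exists>\<gamma> e. e > 0 \<and> \<gamma> C1_differentiable_on {-e<..<e} \<and> \<gamma> ` {-e<..<e} \<subseteq> M \<and>
           \<gamma> 0 = z \<and> (\<gamma> has_vector_derivative v) (at 0)}"

definition normal_space :: "'a::euclidean_space set \<Rightarrow> 'a \<Rightarrow> 'a set" where
  "normal_space M z = (tangent_space M z)\<^sup>\<bottom>"

definition orth_proj :: "'a::euclidean_space set \<Rightarrow> 'a \<Rightarrow> 'a" where
  "orth_proj N w = (THE p. p \<in> N \<and> w - p \<in> N\<^sup>\<bottom>)"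

text \<open>
  The value at tangent vectors \<open>u\<close>, \<open>v\<close> is the normal part of the derivative, in direction \<open>u\<close>,
  of a \<open>C\<^sup>1\<close> vector field \<open>V\<close> that is tangent to \<open>M\<close> and equals \<open>v\<close> at \<open>z\<close>. Where \<open>M\<close> is
  a \<open>C\<^sup>2\<close> submanifold near \<open>z\<close>, such fields exist and the result does not depend on the choice;
  elsewhere the definition is meaningless.
\<close>

definition second_fundamental_form ::
  "'a::euclidean_space set \<Rightarrow> 'a \<Rightarrow> 'a \<Rightarrow> 'a \<Rightarrow> 'a" where
  "second_fundamental_form M z u v =
     (THE w. \<exists>U V. open U \<and> z \<in> U \<and> C1_on U V \<and>
        (\<forall>x\<in>M \<inter> U. V x \<in> tangent_space M x) \<and> V z = v \<and>
        w = orth_proj (normal_space M z) (frechet_derivative V (at z) u))"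

definition orthonormal_basis_of :: "'a::euclidean_space set \<Rightarrow> 'a set \<Rightarrow> bool" where
  "orthonormal_basis_of T E \<longleftrightarrow>
     pairwise orthogonal E \<and> (\<forall>e\<in>E. norm e = 1) \<and> span E = T"

text \<open>
  The trace is computed in an orthonormal basis of the tangent space, and does not depend on it.
  For \<open>k = 0\<close> the sum is empty, and the mean curvature vector is \<open>0\<close>.
\<close>

definition mean_curvature_vector :: "nat \<Rightarrow> 'a::euclidean_space set \<Rightarrow> 'a \<Rightarrow> 'a" where
  "mean_curvature_vector k M z =
     (1 / real k) *\<^sub>R
     (THE s. \<exists>E. orthonormal_basis_of (tangent_space M z) E \<and>
                 s = (\<Sum>e\<in>E. second_fundamental_form M z e e))"

end

theory Submission
  imports Defs
begin

text \<open>
  Let \<open>S\<close> be the support of \<open>\<mu>\<close> and \<open>q\<^sub>z(y) = max 0 (1 - |y - z|\<^sup>2)\<close>. The integral of \<open>q\<^sub>z\<^sup>3\<close> against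
  \<open>\<mu>\<close> depends only on the masses of the balls around \<open>z\<close>, so it is constant for \<open>z \<in> S\<close>. Expanding it to
  second order along curves in \<open>S\<close> through \<open>z\<close>, and summing over an orthonormal basis of the tangent
  space \<open>V\<close>, the terms in the acceleration of the curves pair the mean curvature with a vector normal
  to \<open>S\<close>. If the mean curvature vanishes at \<open>z\<close>, what remains is
  \<open>k \<integral>q\<^sub>z\<^sup>2 d\<mu> = 4 \<integral>q\<^sub>z(y) |\<Pi>\<^sub>V(y - z)|\<^sup>2 d\<mu>(y)\<close>. A computation in polar coordinates gives the same
  identity without the projection \<open>\<Pi>\<^sub>V\<close>, hence \<open>S\<close> lies in \<open>z + V\<close> inside the unit ball around \<open>z\<close>.
  Comparing \<open>\<mu>\<close> with the \<open>k\<close>-dimensional Lebesgue measure of \<open>z + V\<close> shows that \<open>S\<close> fills that ball of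
  \<open>z + V\<close>. Every point of \<open>z + V\<close> in the ball is then flat in turn, so the argument propagates
  along the whole plane.
\<close>

section \<open>Support and radial integrals\<close>

lemma closed_msupport:
  assumes [measurable_cong]: "sets \<mu> = sets borel"
  shows "closed (msupport \<mu>)"
proof -
  have "open (- msupport \<mu>)"
    unfolding open_contains_ball
  proof
    fix x assume "x \<in> - msupport \<mu>"
    then obtain r where r: "r > 0" "emeasure \<mu> (ball x r) = 0"
      unfolding msupport_def by (auto simp: not_less)
    have "y \<in> - msupport \<mu>" if y: "y \<in> ball x r" for y
    proof -
      have "ball y (r - dist x y) \<subseteq> ball x r"
      proof
        fix u assume "u \<in> ball y (r - dist x y)"
        with dist_triangle[of x u y] show "u \<in> ball x r" by simp
      qed
      then have "emeasure \<mu> (ball y (r - dist x y)) = 0"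
        using emeasure_mono[of "ball y (r - dist x y)" "ball x r" \<mu>] r assms by simp
      with y show ?thesis unfolding msupport_def by (auto intro!: exI[of _ "r - dist x y"])
    qed
    with r show "\<exists>e>0. ball x e \<subseteq> - msupport \<mu>" by blast
  qed
  then show ?thesis by (simp add: closed_def)
qed

text \<open>The complement of the support is a union of null balls, and by Lindelof countably many
  of them already cover it.\<close>

lemma AE_in_msupport:
  fixes \<mu> :: "'a::euclidean_space measure"
  assumes "sets \<mu> = sets borel"
  shows "AE x in \<mu>. x \<in> msupport \<mu>"
proof -
  define F where "F = {ball x r | x r. r > 0 \<and> emeasure \<mu> (ball x r) = 0}"
  obtain F' where F': "F' \<subseteq> F" "countable F'" "\<Union>F' = \<Union>F"
    by (rule Lindelof[of F]) (auto simp: F_def)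
  have "(\<Union>S\<in>F'. S) \<in> null_sets \<mu>"
  proof (rule null_sets_UN'[OF F'(2)])
    fix S assume "S \<in> F'"
    with F' have "S \<in> F" by blast
    then show "S \<in> null_sets \<mu>" by (auto simp: F_def null_sets_def assms)
  qed
  moreover have "{x \<in> space \<mu>. x \<notin> msupport \<mu>} \<subseteq> (\<Union>S\<in>F'. S)"
  proof
    fix x assume "x \<in> {x \<in> space \<mu>. x \<notin> msupport \<mu>}"
    then obtain r where "r > 0" "emeasure \<mu> (ball x r) = 0"
      unfolding msupport_def by (auto simp: not_less)
    then have "ball x r \<in> F" "x \<in> ball x r" unfolding F_def by auto
    then show "x \<in> (\<Union>S\<in>F'. S)" unfolding image_ident F'(3) by blast
  qed
  ultimately show ?thesis by (rule AE_I')
qed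

lemma sigma_finite_measure_ball:
  fixes M :: "'a::euclidean_space measure"
  assumes "sets M = sets borel" "\<And>n::nat. emeasure M (ball z (real n)) < \<infinity>"
  shows "sigma_finite_measure M"
proof
  have "\<exists>n::nat. dist z x < real n" for x by (rule reals_Archimedean2)
  then have "(\<Union>n::nat. ball z (real n)) = UNIV" by auto
  moreover have "space M = UNIV" using sets_eq_imp_space_eq[OF assms(1)] by simp
  ultimately show "\<exists>A. countable A \<and> A \<subseteq> sets M \<and> \<Union>A = space M \<and> (\<forall>a\<in>A. emeasure M a \<noteq> \<infinity>)"
    using assms by (intro exI[of _ "range (\<lambda>n::nat. ball z (real n))"]) (auto simp: less_top)
qed

lemma radon_measure_sets: "radon_measure \<mu> \<Longrightarrow> sets \<mu> = sets borel"
  by (simp add: radon_measure_def)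

lemma radon_measure_compact: "radon_measure \<mu> \<Longrightarrow> compact K \<Longrightarrow> emeasure \<mu> K < \<infinity>"
  unfolding radon_measure_def by blast

lemma radon_measure_finite_ball:
  assumes "radon_measure \<mu>"
  shows "emeasure \<mu> (ball x r) < \<infinity>"
proof -
  have "emeasure \<mu> (ball x r) \<le> emeasure \<mu> (cball x r)"
    using assms by (intro emeasure_mono) (auto simp: radon_measure_sets)
  also have "\<dots> < \<infinity>" using assms by (intro radon_measure_compact) auto
  finally show ?thesis .
qed

lemma radon_measure_sigma_finite: "radon_measure \<mu> \<Longrightarrow> sigma_finite_measure \<mu>"
  using sigma_finite_measure_ball[of \<mu> 0] radon_measure_finite_ball radon_measure_sets by blast

lemma locally_uniform_radon: "locally_uniform k \<mu> \<Longrightarrow> radon_measure \<mu>"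
  by (simp add: locally_uniform_def)

lemma locally_uniform_ball:
  "locally_uniform k \<mu> \<Longrightarrow> x \<in> msupport \<mu> \<Longrightarrow> 0 < r \<Longrightarrow> r \<le> 1 \<Longrightarrow>
     emeasure \<mu> (ball x r) = ennreal (unit_ball_vol (real k) * r ^ k)"
  by (simp add: locally_uniform_def)

text \<open>A ball that meets the support lies in a ball of twice the radius centred at a support
  point; one that misses it is null. The bound 1/2 keeps the doubled radius in the range of local
  uniformity.\<close>

lemma locally_uniform_ball_le:
  assumes "locally_uniform k \<mu>" "0 < r" "r \<le> 1/2"
  shows "emeasure \<mu> (ball x r) \<le> ennreal (unit_ball_vol (real k) * (2 * r) ^ k)"
proof (cases "ball x r \<inter> msupport \<mu> = {}")
  case True
  have s: "sets \<mu> = sets borel"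
    by (rule radon_measure_sets[OF locally_uniform_radon[OF assms(1)]])
  have "AE y in \<mu>. y \<notin> ball x r" using AE_in_msupport[OF s] by eventually_elim (use True in blast)
  moreover have "{y \<in> space \<mu>. \<not> y \<notin> ball x r} = ball x r"
    by (auto simp: sets_eq_imp_space_eq[OF s])
  ultimately have "emeasure \<mu> (ball x r) = 0"
    using AE_iff_measurable[of "ball x r" \<mu> "\<lambda>y. y \<notin> ball x r"] by (simp add: s)
  then show ?thesis by simp
next
  case False
  then obtain y where y: "y \<in> ball x r" "y \<in> msupport \<mu>" by blast
  have "ball x r \<subseteq> ball y (2 * r)"
  proof
    fix u assume "u \<in> ball x r"
    with y dist_triangle[of y u x] show "u \<in> ball y (2*r)" by (simp add: dist_commute)
  qed
  then have "emeasure \<mu> (ball x r) \<le> emeasure \<mu> (ball y (2 * r))"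
    by (intro emeasure_mono) (simp_all add: radon_measure_sets[OF locally_uniform_radon[OF assms(1)]])
  also have "\<dots> = ennreal (unit_ball_vol (real k) * (2 * r) ^ k)"
    using assms y by (intro locally_uniform_ball) auto
  finally show ?thesis .
qed

section \<open>Integrals of radial weights from the masses of balls\<close>

lemma nn_integral_one_minus_square:
  fixes d :: real
  assumes "0 \<le> d"
  shows "ennreal (max 0 (1 - d\<^sup>2) ^ Suc m) =
    (\<integral>\<^sup>+s. ennreal (2 * (real m + 1) * s * (1 - s\<^sup>2) ^ m) * indicator {0..1} s * indicator {d<..} s \<partial>lborel)"
proof (cases "d < 1")
  case True
  have d2: "d\<^sup>2 \<le> 1" using True assms by (simp add: power_le_one)
  have "(\<integral>\<^sup>+s. ennreal (2 * (real m + 1) * s * (1 - s\<^sup>2) ^ m) * indicator {0..1} s * indicator {d<..} s \<partial>lborel)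
      = (\<integral>\<^sup>+s. ennreal (2 * (real m + 1) * s * (1 - s\<^sup>2) ^ m) * indicator {d..1} s \<partial>lborel)"
    using AE_lborel_singleton[of d] assms
    by (intro nn_integral_cong_AE) (auto elim!: eventually_mono simp: indicator_def)
  also have "\<dots> = ennreal (- ((1 - 1\<^sup>2) ^ Suc m) - (- ((1 - d\<^sup>2) ^ Suc m)))"
  proof (rule nn_integral_FTC_Icc[where F = "\<lambda>s. - ((1 - s\<^sup>2) ^ Suc m)"])
    show "d \<le> 1" using True by simp
    fix s assume s: "s \<in> {d..1}"
    show "0 \<le> 2 * (real m + 1) * s * (1 - s\<^sup>2) ^ m"
      using s assms by (simp add: power_le_one)
    show "((\<lambda>s. - ((1 - s\<^sup>2) ^ Suc m)) has_field_derivative 2 * (real m + 1) * s * (1 - s\<^sup>2) ^ m) (at s)"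
    proof -
      have "((\<lambda>s. 1 - s\<^sup>2) has_field_derivative - (2 * s)) (at s)"
        by (auto intro!: derivative_eq_intros)
      from DERIV_minus[OF DERIV_power_Suc[OF this]] show ?thesis
        by (rule DERIV_cong) (simp add: algebra_simps)
    qed
  qed simp
  also have "\<dots> = ennreal (max 0 (1 - d\<^sup>2) ^ Suc m)" using d2 by (simp add: max_def)
  finally show ?thesis by simp
next
  case False
  then have "d\<^sup>2 \<ge> 1" by (simp add: one_le_power)
  moreover have "(\<integral>\<^sup>+s. ennreal (2 * (real m + 1) * s * (1 - s\<^sup>2) ^ m) * indicator {0..1} s * indicator {d<..} s \<partial>lborel) = (\<integral>\<^sup>+s. 0 \<partial>(lborel :: real measure))"
    using False by (intro nn_integral_cong) (auto simp: indicator_def)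
  ultimately show ?thesis by (simp add: max_def)
qed

text \<open>Layer cake: the weight at \<open>y\<close> is an integral over the radii
  \<open>s > dist x y\<close>, strict so that Tonelli leaves the mass of the open ball
  \<open>ball x s\<close>. Only radii up to 1 occur, so local uniformity determines the value,
  independently of the centre.\<close>

lemma nn_integral_radial:
  fixes M :: "'a::euclidean_space measure"
  assumes [measurable_cong]: "sets M = sets borel" and "sigma_finite_measure M"
    and ball: "\<And>r. 0 < r \<Longrightarrow> r \<le> 1 \<Longrightarrow> emeasure M (ball x r) = ennreal (c * r ^ k)" and "0 \<le> c"
  shows "(\<integral>\<^sup>+y. ennreal (max 0 (1 - (dist x y)\<^sup>2) ^ Suc m) \<partial>M) =
    (\<integral>\<^sup>+s. ennreal (2 * (real m + 1) * s * (1 - s\<^sup>2) ^ m * (c * s ^ k)) * indicator {0..1} s \<partial>lborel)"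
proof -
  interpret M: sigma_finite_measure M by fact
  interpret pair_sigma_finite "lborel :: real measure" M ..
  let ?g = "\<lambda>s. ennreal (2 * (real m + 1) * s * (1 - s\<^sup>2) ^ m) * indicator {0..1} s"
  have [measurable]: "Measurable.pred (lborel \<Otimes>\<^sub>M M) (\<lambda>(s,y). dist x y < s)"
    by measurable
  have meas: "(\<lambda>(s,y). ?g s * indicator {dist x y<..} s) \<in> borel_measurable (lborel \<Otimes>\<^sub>M M)"
    unfolding indicator_def greaterThan_iff by measurable
  have "(\<integral>\<^sup>+y. ennreal (max 0 (1 - (dist x y)\<^sup>2) ^ Suc m) \<partial>M) =
     (\<integral>\<^sup>+y. (\<integral>\<^sup>+s. ?g s * indicator {dist x y<..} s \<partial>lborel) \<partial>M)"
    by (intro nn_integral_cong nn_integral_one_minus_square) simp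
  also have "\<dots> = (\<integral>\<^sup>+s. (\<integral>\<^sup>+y. ?g s * indicator {dist x y<..} s \<partial>M) \<partial>lborel)"
    by (rule Fubini'[OF meas])
  also have "\<dots> = (\<integral>\<^sup>+s. (\<integral>\<^sup>+y. ?g s * indicator (ball x s) y \<partial>M) \<partial>lborel)"
    by (intro nn_integral_cong) (auto simp: indicator_def)
  also have "\<dots> = (\<integral>\<^sup>+s. ?g s * emeasure M (ball x s) \<partial>lborel)"
    by (intro nn_integral_cong nn_integral_cmult_indicator) (simp add: assms)
  also have "\<dots> = (\<integral>\<^sup>+s. ennreal (2 * (real m + 1) * s * (1 - s\<^sup>2) ^ m * (c * s ^ k)) * indicator {0..1} s \<partial>lborel)"
  proof (rule nn_integral_cong)
    fix s :: real
    show "?g s * emeasure M (ball x s) = ennreal (2 * (real m + 1) * s * (1 - s\<^sup>2) ^ m * (c * s ^ k)) * indicator {0..1} s"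
    proof (cases "0 < s \<and> s \<le> 1")
      case True
      then have "0 \<le> 2 * (real m + 1) * s * (1 - s\<^sup>2) ^ m" by (simp add: power_le_one)
      with True ball[of s] \<open>0 \<le> c\<close> show ?thesis
        by (simp add: indicator_def ennreal_mult)
    qed (auto simp: indicator_def)
  qed
  finally show ?thesis .
qed

text \<open>This value and the next carry the polar-coordinate identity: their ratio is
  \<open>(k + 4) / 4\<close>, so the difference of the two integrals, which is the weighted integral
  of the squared distance, is \<open>k / 4\<close> times the second one.\<close>

lemma nn_integral_radial_1:
  fixes M :: "'a::euclidean_space measure"
  assumes "sets M = sets borel" and "sigma_finite_measure M"
    and ball: "\<And>r. 0 < r \<Longrightarrow> r \<le> 1 \<Longrightarrow> emeasure M (ball x r) = ennreal (c * r ^ k)" and "0 \<le> c"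
  shows "(\<integral>\<^sup>+y. ennreal (max 0 (1 - (dist x y)\<^sup>2)) \<partial>M) = ennreal (2 * c / (k + 2))"
proof -
  have "(\<integral>\<^sup>+y. ennreal (max 0 (1 - (dist x y)\<^sup>2)) \<partial>M) = 
    (\<integral>\<^sup>+s. ennreal (2 * s * (c * s ^ k)) * indicator {0..1} s \<partial>lborel)"
    using nn_integral_radial[OF assms, of 0] by simp
  also have "\<dots> = ennreal (2 * c / (k + 2) * 1 ^ (k + 2) - 2 * c / (k + 2) * 0 ^ (k + 2))"
  proof (rule nn_integral_FTC_Icc[where F = "\<lambda>s. 2 * c / (k + 2) * s ^ (k + 2)"])
    fix s :: real assume s: "s \<in> {0..1}"
    show "0 \<le> 2 * s * (c * s ^ k)" using s assms by simp
    show "((\<lambda>s. 2 * c / (k + 2) * s ^ (k + 2)) has_field_derivative 2 * s * (c * s ^ k)) (at s)"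
      by (rule derivative_eq_intros refl)+ (simp add: field_simps)
  qed auto
  finally show ?thesis by simp
qed

lemma nn_integral_radial_2:
  fixes M :: "'a::euclidean_space measure"
  assumes "sets M = sets borel" and "sigma_finite_measure M"
    and ball: "\<And>r. 0 < r \<Longrightarrow> r \<le> 1 \<Longrightarrow> emeasure M (ball x r) = ennreal (c * r ^ k)" and "0 \<le> c"
  shows "(\<integral>\<^sup>+y. ennreal (max 0 (1 - (dist x y)\<^sup>2) ^ 2) \<partial>M) = ennreal (8 * c / ((k + 2) * (k + 4)))"
proof -
  let ?F = "\<lambda>s::real. 4 * c * (1 / (k + 2) * s ^ (k + 2) - 1 / (k + 4) * s ^ (k + 4))"
  have "(\<integral>\<^sup>+y. ennreal (max 0 (1 - (dist x y)\<^sup>2) ^ 2) \<partial>M) = 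
    (\<integral>\<^sup>+s. ennreal (4 * s * (1 - s\<^sup>2) * (c * s ^ k)) * indicator {0..1} s \<partial>lborel)"
    using nn_integral_radial[OF assms, of 1] by (simp add: power2_eq_square)
  also have "\<dots> = ennreal (?F 1 - ?F 0)"
  proof (rule nn_integral_FTC_Icc[where F = ?F])
    fix s :: real assume s: "s \<in> {0..1}"
    show "0 \<le> 4 * s * (1 - s\<^sup>2) * (c * s ^ k)" using s assms by (simp add: power_le_one)
    have "(?F has_field_derivative 4 * c * (1 / (k + 2) * ((k + 2) * s ^ (k + 1)) - 1 / (k + 4) * ((k + 4) * s ^ (k + 3)))) (at s)"
      by (rule derivative_eq_intros refl)+ (simp add: eval_nat_numeral)
    also have "4 * c * (1 / (k + 2) * ((k + 2) * s ^ (k + 1)) - 1 / (k + 4) * ((k + 4) * s ^ (k + 3))) = 4 * c * (s ^ (k + 1) - s ^ (k + 3))"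
      by (simp del: of_nat_add)
    also have "\<dots> = 4 * s * (1 - s\<^sup>2) * (c * s ^ k)"
      by (simp add: algebra_simps power_add eval_nat_numeral)
    finally show "(?F has_field_derivative 4 * s * (1 - s\<^sup>2) * (c * s ^ k)) (at s)" .
  qed auto
  also have "?F 1 - ?F 0 = 8 * c / ((k + 2) * (k + 4))"
  proof -
    have eq: "1 / a - 1 / (a + 2) = 2 / (a * (a + 2))" if "0 < a" for a :: real
      using that by (simp add: field_simps)
    have "?F 1 - ?F 0 = 4 * c * (1 / (real k + 2) - 1 / ((real k + 2) + 2))"
      by (simp add: zero_power add.commute)
    also have "\<dots> = 4 * c * (2 / ((real k + 2) * ((real k + 2) + 2)))"
      by (subst eq) simp_all
    also have "\<dots> = 8 * c / ((k + 2) * (k + 4))" by simp (simp add: algebra_simps)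
    finally show ?thesis .
  qed
  finally show ?thesis .
qed

section \<open>Lebesgue measure on a plane\<close>

text \<open>Moves a ball with arbitrary centre to the origin, where the volume formula
  \<open>emeasure_cball_aux\<close> applies. A product measure is determined by boxes, and on boxes
  the claim is translation invariance in each coordinate.\<close>

lemma distr_PiM_lborel_translate:
  assumes "finite I"
  shows "distr (Pi\<^sub>M I (\<lambda>_. lborel :: real measure)) (Pi\<^sub>M I (\<lambda>_. lborel)) (\<lambda>f. \<lambda>i\<in>I. f i + a i) = Pi\<^sub>M I (\<lambda>_. lborel)"
proof -
  interpret product_sigma_finite "\<lambda>_. lborel :: real measure" by standard
  let ?P = "Pi\<^sub>M I (\<lambda>_. lborel :: real measure)"
  let ?t = "\<lambda>f. \<lambda>i\<in>I. f i + a i"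
  have t[measurable]: "?t \<in> ?P \<rightarrow>\<^sub>M ?P" by measurable
  show ?thesis
  proof (rule PiM_eqI[OF assms])
    show "sets (distr ?P ?P ?t) = sets ?P" by simp
    fix A assume A: "\<And>i. i \<in> I \<Longrightarrow> A i \<in> sets (lborel :: real measure)"
    have meas: "(\<lambda>s. s + a i) -` A i \<in> sets lborel" if "i \<in> I" for i
      using measurable_sets[of "\<lambda>s. s + a i" lborel lborel "A i"] A[OF that] by simp
    have shift: "emeasure lborel ((\<lambda>s. s + a i) -` A i) = emeasure lborel (A i)" if "i \<in> I" for i
    proof -
      have "emeasure lborel (A i) = emeasure (distr lborel borel ((+) (a i))) (A i)"
        using lborel_distr_plus[of "a i"] by simp
      also have "\<dots> = emeasure lborel ((+) (a i) -` A i \<inter> space lborel)"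
        using A[OF that] by (intro emeasure_distr) auto
      finally show ?thesis by (simp add: add.commute[of _ "a i"])
    qed
    have "emeasure (distr ?P ?P ?t) (Pi\<^sub>E I A) = emeasure ?P (?t -` Pi\<^sub>E I A \<inter> space ?P)"
      using A by (intro emeasure_distr t sets_PiM_I_finite assms) auto
    also have "?t -` Pi\<^sub>E I A \<inter> space ?P = Pi\<^sub>E I (\<lambda>i. (\<lambda>s. s + a i) -` A i)"
      by (auto simp: space_PiM PiE_iff)
    also have "emeasure ?P \<dots> = (\<Prod>i\<in>I. emeasure lborel ((\<lambda>s. s + a i) -` A i))"
      using meas by (intro emeasure_PiM assms) auto
    also have "\<dots> = (\<Prod>i\<in>I. emeasure lborel (A i))"
      by (intro prod.cong) (simp_all add: shift)
    finally show "emeasure (distr ?P ?P ?t) (Pi\<^sub>E I A) = (\<Prod>i\<in>I. emeasure lborel (A i))" .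
  qed
qed

lemma norm_sum_orthonormal:
  fixes E :: "'a::euclidean_space set"
  assumes "finite E" "pairwise orthogonal E" "\<And>e. e \<in> E \<Longrightarrow> norm e = 1"
  shows "norm (\<Sum>e\<in>E. c e *\<^sub>R e) = sqrt (\<Sum>e\<in>E. (c e)\<^sup>2)"
proof -
  have "pairwise (\<lambda>i j. orthogonal (c i *\<^sub>R i) (c j *\<^sub>R j)) E"
    using assms(2) by (auto simp: pairwise_def orthogonal_def)
  from norm_sum_Pythagorean[OF assms(1) this] have "(norm (\<Sum>e\<in>E. c e *\<^sub>R e))\<^sup>2 = (\<Sum>e\<in>E. (c e)\<^sup>2)"
    using assms(3) by simp
  then show ?thesis by (metis norm_ge_zero real_sqrt_unique)
qed

lemma tendsto_1_over_n_plus_2: "(\<lambda>n. 1 / real (n + 2)) \<longlonglongrightarrow> 0"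
  by (rule LIMSEQ_ignore_initial_segment[OF lim_1_over_n])

lemma tendsto_shrink_radius: "(\<lambda>n. r * (1 - 1 / real (n + 2))) \<longlonglongrightarrow> r"
proof -
  have "(\<lambda>n. r * (1 - 1 / real (n + 2))) \<longlonglongrightarrow> r * (1 - 0)"
    by (intro tendsto_intros tendsto_1_over_n_plus_2)
  then show ?thesis by simp
qed

text \<open>The volume formula concerns closed balls, local uniformity open ones; this exhaustion
  passes from one to the other. The offset 2 keeps every radius positive.\<close>

lemma ball_eq_Union_cball:
  fixes x :: "'a::metric_space"
  assumes "0 < r"
  shows "ball x r = (\<Union>n. cball x (r * (1 - 1 / real (n + 2))))"
proof (intro set_eqI iffI)
  fix y assume "y \<in> ball x r"
  then have "dist x y < r" by simp
  moreover have "(\<lambda>n. r * (1 - 1 / real (n + 2))) \<longlonglongrightarrow> r" by (rule tendsto_shrink_radius)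
  ultimately have "\<forall>\<^sub>F n in sequentially. dist x y < r * (1 - 1 / real (n + 2))"
    by (rule order_tendstoD(1)[rotated])
  then obtain n where "dist x y < r * (1 - 1 / real (n + 2))"
    by (auto simp: eventually_sequentially)
  then show "y \<in> (\<Union>n. cball x (r * (1 - 1 / real (n + 2))))" by (auto intro!: exI[of _ n])
next
  fix y assume "y \<in> (\<Union>n. cball x (r * (1 - 1 / real (n + 2))))"
  then obtain n where "dist x y \<le> r * (1 - 1 / real (n + 2))" by auto
  also have "\<dots> < r" using assms by (simp add: field_simps)
  finally show "y \<in> ball x r" by simp
qed

text \<open>The comparison measure is Lebesgue measure of the plane \<open>z + span E\<close>, seen
  as a measure on the whole space: the image of the product measure under orthonormal coordinates.
  With \<open>card E = k\<close> its balls centred on the plane have the masses that local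
  uniformity prescribes at support points.\<close>

lemma exists_plane_measure:
  fixes E :: "'a::euclidean_space set"
  assumes E: "finite E" "pairwise orthogonal E" "\<And>e. e \<in> E \<Longrightarrow> norm e = 1"
  obtains L :: "'a measure" where "sets L = sets borel"
    "\<And>v r. v \<in> span E \<Longrightarrow> 0 < r \<Longrightarrow>
       emeasure L (ball (z + v) r) = ennreal (unit_ball_vol (real (card E)) * r ^ card E)"
proof -
  let ?P = "Pi\<^sub>M E (\<lambda>_. lborel :: real measure)"
  define \<phi> where "\<phi> f = z + (\<Sum>e\<in>E. f e *\<^sub>R e)" for f :: "'a \<Rightarrow> real"
  have \<phi>[measurable]: "\<phi> \<in> ?P \<rightarrow>\<^sub>M borel" unfolding \<phi>_def by measurable
  define L where "L = distr ?P borel \<phi>"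
  have L: "sets L = sets borel" by (simp add: L_def)
  let ?c = "unit_ball_vol (real (card E))"
  have cball: "emeasure L (cball (z + v) r) = ennreal (?c * r ^ card E)" if v: "v \<in> span E" and r: "r > 0" for v r
  proof -
    obtain a where a: "v = (\<Sum>e\<in>E. a e *\<^sub>R e)"
      using v span_finite[OF E(1)] by auto
    \<comment> \<open>Shift by the coordinates of \<open>v\<close>: after it, the distance to
      \<open>z + v\<close> is the Euclidean norm of the coordinate vector.\<close>
    let ?t = "\<lambda>f. \<lambda>i\<in>E. f i + a i"
    have t: "?t \<in> ?P \<rightarrow>\<^sub>M ?P" by measurable
    have "emeasure L (cball (z + v) r) = emeasure ?P (\<phi> -` cball (z + v) r \<inter> space ?P)"
      unfolding L_def by (intro emeasure_distr \<phi>) simp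
    also have "\<dots> = emeasure (distr ?P ?P ?t) (\<phi> -` cball (z + v) r \<inter> space ?P)"
      by (simp add: distr_PiM_lborel_translate[OF E(1)])
    also have "\<dots> = emeasure ?P (?t -` (\<phi> -` cball (z + v) r \<inter> space ?P) \<inter> space ?P)"
      by (intro emeasure_distr t measurable_sets[OF \<phi>]) simp
    also have "?t -` (\<phi> -` cball (z + v) r \<inter> space ?P) \<inter> space ?P = {f. sqrt (\<Sum>i\<in>E. (f i)\<^sup>2) \<le> r} \<inter> space ?P"
    proof -
      have "dist (z + v) (\<phi> (?t f)) = sqrt (\<Sum>i\<in>E. (f i)\<^sup>2)" for f
      proof -
        have "\<phi> (?t f) - (z + v) = (\<Sum>e\<in>E. f e *\<^sub>R e)"
          by (simp add: \<phi>_def a scaleR_add_left sum.distrib)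
        moreover have "dist (z + v) (\<phi> (?t f)) = norm (\<phi> (?t f) - (z + v))"
          by (simp only: dist_norm norm_minus_commute)
        ultimately show ?thesis using norm_sum_orthonormal[OF E] by simp
      qed
      then show ?thesis by (auto simp: space_PiM)
    qed
    also have "emeasure ?P \<dots> = ennreal (?c * r ^ card E)"
      by (rule emeasure_cball_aux) fact+
    finally show ?thesis .
  qed
  show thesis
  proof (rule that[OF L])
    fix v and r :: real assume v: "v \<in> span E" and r: "r > 0"
    let ?r = "\<lambda>n. r * (1 - 1 / real (n + 2))"
    have "(\<lambda>n. emeasure L (cball (z + v) (?r n))) \<longlonglongrightarrow> emeasure L (\<Union>n. cball (z + v) (?r n))"
    proof (rule Lim_emeasure_incseq)
      show "incseq (\<lambda>n. cball (z + v) (?r n))"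
      proof (rule incseq_SucI)
        fix n
        have "?r n \<le> ?r (Suc n)" using r by (intro mult_left_mono) (auto simp: field_simps)
        then show "cball (z + v) (?r n) \<subseteq> cball (z + v) (?r (Suc n))" by auto
      qed
    qed (simp add: L image_subset_iff)
    moreover have "(\<lambda>n. emeasure L (cball (z + v) (?r n))) \<longlonglongrightarrow> ennreal (?c * r ^ card E)"
    proof -
      have "?r n > 0" for n using r by simp
      then have "emeasure L (cball (z + v) (?r n)) = ennreal (?c * ?r n ^ card E)" for n
        using cball[OF v] by blast
      moreover have "?r \<longlonglongrightarrow> r" by (rule tendsto_shrink_radius)
      then have "(\<lambda>n. ennreal (?c * ?r n ^ card E)) \<longlonglongrightarrow> ennreal (?c * r ^ card E)"
        by (intro tendsto_intros)
      ultimately show ?thesis by simp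
    qed
    ultimately show "emeasure L (ball (z + v) r) = ennreal (?c * r ^ card E)"
      unfolding ball_eq_Union_cball[OF r] by (rule LIMSEQ_unique)
  qed
qed

section \<open>Flatness from the second-order expansion\<close>

text \<open>Upgrades almost-everywhere statements to all support points: around a support point an
  open set contains a ball of positive mass.\<close>

lemma open_Int_msupport_empty:
  assumes "sets \<mu> = sets borel" "open U" "AE x in \<mu>. x \<notin> U"
  shows "U \<inter> msupport \<mu> = {}"
proof (rule ccontr)
  assume "U \<inter> msupport \<mu> \<noteq> {}"
  then obtain x where x: "x \<in> U" "x \<in> msupport \<mu>" by blast
  obtain r where r: "r > 0" "ball x r \<subseteq> U" using assms(2) x openE by blast
  have "{y \<in> space \<mu>. \<not> y \<notin> U} = U" by (auto simp: sets_eq_imp_space_eq[OF assms(1)])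
  then have "emeasure \<mu> U = 0"
    using AE_iff_measurable[of U \<mu> "\<lambda>y. y \<notin> U"] assms by simp
  then have "emeasure \<mu> (ball x r) = 0"
    using emeasure_mono[OF r(2), of \<mu>] assms by simp
  with x(2) r(1) show False by (auto simp: msupport_def)
qed

section \<open>The truncated weight, its Taylor expansion and its moments\<close>

lemma cube_max_expansion:
  fixes a b :: real
  shows "\<bar>max 0 b ^ 3 - max 0 a ^ 3 - 3 * (max 0 a)\<^sup>2 * (b - a) - 3 * max 0 a * (b - a)\<^sup>2\<bar> \<le> \<bar>b - a\<bar> ^ 3"
proof -
  \<comment> \<open>The third power makes the positive part twice continuously differentiable, so a
    quadratic expansion survives the kink. For two nonnegative arguments the error is
    \<open>(b - a) ^ 3\<close>, for two negative ones 0; a change of sign is settled by comparing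
    cubes.\<close>
  consider "0 \<le> a" "0 \<le> b" | "0 \<le> a" "b < 0" | "a < 0" "0 \<le> b" | "a < 0" "b < 0" by linarith
  then show ?thesis
  proof cases
    case 1
    have "b ^ 3 - a ^ 3 - 3 * a\<^sup>2 * (b - a) - 3 * a * (b - a)\<^sup>2 = (b - a) ^ 3" by algebra
    with 1 show ?thesis by (simp add: max_def power_abs)
  next
    case 2
    have "- (a ^ 3) - 3 * a\<^sup>2 * (b - a) - 3 * a * (b - a)\<^sup>2 = (- b) ^ 3 - (a - b) ^ 3" by algebra
    moreover have "(- b) ^ 3 \<le> (a - b) ^ 3" using 2 by (intro power_mono) auto
    moreover have "0 \<le> (- b) ^ 3" using 2 by (intro zero_le_power) auto
    ultimately show ?thesis using 2 by (simp add: max_def)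
  next
    case 3
    have "b ^ 3 \<le> (b - a) ^ 3" "0 \<le> b ^ 3" using 3 by (auto intro!: power_mono)
    with 3 show ?thesis by (simp add: max_def)
  qed (simp add: max_def)
qed

text \<open>This is q_z of the overview. Squaring the distance makes the increment under a shift of
  the centre a polynomial in the shift, as long as the truncation is not active.\<close>

definition bump :: "'a::euclidean_space \<Rightarrow> 'a \<Rightarrow> real" where
  "bump z y = max 0 (1 - (dist z y)\<^sup>2)"

lemma bump_nonneg: "0 \<le> bump z y" and bump_le_1: "bump z y \<le> 1"
  by (auto simp: bump_def)

lemma bump_pos_iff: "0 < bump z y \<longleftrightarrow> dist z y < 1"
proof -
  have "0 < bump z y \<longleftrightarrow> (dist z y)\<^sup>2 < 1\<^sup>2" by (auto simp: bump_def)
  also have "\<dots> \<longleftrightarrow> dist z y < 1" using abs_square_less_1[of "dist z y"] by simp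
  finally show ?thesis .
qed

lemma continuous_on_bump [continuous_intros]: "continuous_on UNIV (bump z)"
  unfolding bump_def by (intro continuous_intros)

lemma borel_measurable_bump_power:
  "sets \<mu> = sets borel \<Longrightarrow> (\<lambda>y. bump z y ^ n) \<in> borel_measurable \<mu>"
  using borel_measurable_continuous_onI[of "\<lambda>y. bump z y ^ n"] measurable_cong_sets[of \<mu> borel borel borel]
  by (auto intro!: continuous_intros)

lemma bump_eq_0: "1 \<le> dist z y \<Longrightarrow> bump z y = 0"
  using bump_pos_iff[of z y] bump_nonneg[of z y] by auto

lemma integrable_ball_support:
  fixes f :: "'a::euclidean_space \<Rightarrow> 'b::euclidean_space"
  assumes "radon_measure \<mu>" "continuous_on UNIV f"
    and "\<And>y. dist z y < R \<Longrightarrow> norm (f y) \<le> C" "\<And>y. R \<le> dist z y \<Longrightarrow> f y = 0"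
  shows "integrable \<mu> f"
proof (rule Bochner_Integration.integrable_bound)
  have s: "sets \<mu> = sets borel" by (rule radon_measure_sets) fact
  show "integrable \<mu> (\<lambda>y. C * indicator (ball z R) y :: real)"
    using radon_measure_finite_ball[OF assms(1)] by (intro integrable_mult_right integrable_real_indicator) (simp_all add: s)
  show "f \<in> borel_measurable \<mu>"
    using borel_measurable_continuous_onI[OF assms(2)] measurable_cong_sets[OF s refl] by blast
  show "AE y in \<mu>. norm (f y) \<le> norm (C * indicator (ball z R) y :: real)"
    using assms(3,4) by (intro AE_I2) (force simp: indicator_def not_less)
qed

text \<open>Apply \<open>cube_max_expansion\<close> to the increment \<open>d\<close> of one minus
  the squared distance. Here 125 comes from \<open>\<bar>d\<bar> \<le> 5 * norm h\<close>, and 27 =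
  3 + 24 from the terms of order four and three in \<open>3 * bump z y * d\<^sup>2\<close>. Beyond
  distance 2 from \<open>z\<close> both weights vanish.\<close>

lemma bump_expansion:
  fixes z h y :: "'a::euclidean_space"
  assumes h: "norm h \<le> 1"
  shows "\<bar>bump (z + h) y ^ 3 - bump z y ^ 3 + 3 * (norm h)\<^sup>2 * (bump z y)\<^sup>2
     - 6 * ((bump z y)\<^sup>2 * inner h (y - z)) - 12 * (bump z y * (inner h (y - z))\<^sup>2)\<bar>
     \<le> 152 * norm h ^ 3 * indicator (ball z 2) y" (is "\<bar>?L\<bar> \<le> _")
proof (cases "dist z y < 2")
  case True
  define d where "d = 2 * inner h (y - z) - (norm h)\<^sup>2"
  let ?q = "bump z y"
  have ip: "\<bar>inner h (y - z)\<bar> \<le> norm h * 2"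
    using Cauchy_Schwarz_ineq2[of h "y - z"] True mult_left_mono[of "norm (y - z)" 2 "norm h"]
    by (simp add: dist_norm norm_minus_commute)
  have "(dist (z + h) y)\<^sup>2 = (dist z y)\<^sup>2 - d"
    unfolding d_def dist_norm power2_norm_eq_inner by (simp add: algebra_simps inner_commute)
  then have "(1 - (dist (z + h) y)\<^sup>2) - (1 - (dist z y)\<^sup>2) = d" by simp
  with cube_max_expansion[of "1 - (dist (z + h) y)\<^sup>2" "1 - (dist z y)\<^sup>2"]
  have 1: "\<bar>bump (z + h) y ^ 3 - ?q ^ 3 - 3 * ?q\<^sup>2 * d - 3 * ?q * d\<^sup>2\<bar> \<le> \<bar>d\<bar> ^ 3"
    unfolding bump_def by simp
  have "(norm h)\<^sup>2 \<le> norm h" using h by (simp add: power2_eq_square mult_left_le)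
  then have "\<bar>d\<bar> \<le> 5 * norm h"
    using ip zero_le_power2[of "norm h"] unfolding d_def by linarith
  then have "\<bar>d\<bar> ^ 3 \<le> (5 * norm h) ^ 3" by (rule power_mono) simp
  then have 2: "\<bar>d\<bar> ^ 3 \<le> 125 * norm h ^ 3" by (simp add: power_mult_distrib)
  have "?L = (bump (z + h) y ^ 3 - ?q ^ 3 - 3 * ?q\<^sup>2 * d - 3 * ?q * d\<^sup>2)
      + ?q * (3 * (norm h) ^ 4 - 12 * (norm h)\<^sup>2 * inner h (y - z))"
    unfolding d_def by algebra
  moreover have "\<bar>?q * (3 * (norm h) ^ 4 - 12 * (norm h)\<^sup>2 * inner h (y - z))\<bar> \<le> 27 * norm h ^ 3"
  proof -
    have "norm h ^ 4 \<le> norm h ^ 3" using h by (intro power_decreasing) auto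
    moreover have "\<bar>(norm h)\<^sup>2 * inner h (y - z)\<bar> \<le> (norm h)\<^sup>2 * (norm h * 2)"
      unfolding abs_mult using ip by (auto intro!: mult_left_mono)
    moreover have "(norm h)\<^sup>2 * (norm h * 2) = 2 * norm h ^ 3"
      by (simp add: power2_eq_square power3_eq_cube)
    moreover have "0 \<le> norm h ^ 4" by simp
    ultimately have "\<bar>3 * (norm h) ^ 4 - 12 * ((norm h)\<^sup>2 * inner h (y - z))\<bar> \<le> 27 * norm h ^ 3"
      by linarith
    then have "\<bar>3 * (norm h) ^ 4 - 12 * (norm h)\<^sup>2 * inner h (y - z)\<bar> \<le> 27 * norm h ^ 3"
      by (simp only: mult.assoc)
    moreover have "\<bar>?q * x\<bar> \<le> \<bar>x\<bar>" for x
      using mult_right_mono[OF bump_le_1[of z y], of "\<bar>x\<bar>"] by (simp add: abs_mult bump_nonneg)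
    ultimately show ?thesis using order_trans by blast
  qed
  ultimately have "\<bar>?L\<bar> \<le> 125 * norm h ^ 3 + 27 * norm h ^ 3" using 1 2 by linarith
  with True show ?thesis by simp
next
  case False
  then have "dist (z + h) y \<ge> 1"
    using dist_triangle[of z y "z + h"] h by (simp add: dist_norm)
  then have "bump (z + h) y = 0" "bump z y = 0" using False by (auto intro!: bump_eq_0)
  then show ?thesis by simp
qed

lemma integral_bump_1:
  assumes "locally_uniform k \<mu>" "x \<in> msupport \<mu>"
  shows "(\<integral>y. bump x y \<partial>\<mu>) = 2 * unit_ball_vol k / (k + 2)"
proof -
  note r = locally_uniform_radon[OF assms(1)]
  have "(\<integral>\<^sup>+y. ennreal (bump x y) \<partial>\<mu>) = ennreal (2 * unit_ball_vol k / (k + 2))"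
    unfolding bump_def
    by (rule nn_integral_radial_1[OF radon_measure_sets[OF r] radon_measure_sigma_finite[OF r]])
      (simp_all add: locally_uniform_ball[OF assms])
  then show ?thesis
    by (intro integral_eq_nn_integral[THEN trans])
      (simp_all add: bump_nonneg borel_measurable_bump_power[OF radon_measure_sets[OF r]]
        borel_measurable_bump_power[OF radon_measure_sets[OF r], where n = 1, simplified])
qed

lemma integral_bump_2:
  assumes "locally_uniform k \<mu>" "x \<in> msupport \<mu>"
  shows "(\<integral>y. (bump x y)\<^sup>2 \<partial>\<mu>) = 8 * unit_ball_vol k / ((k + 2) * (k + 4))"
proof -
  note r = locally_uniform_radon[OF assms(1)]
  have "(\<integral>\<^sup>+y. ennreal ((bump x y)\<^sup>2) \<partial>\<mu>) = ennreal (8 * unit_ball_vol k / ((k + 2) * (k + 4)))"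
    unfolding bump_def
    by (rule nn_integral_radial_2[OF radon_measure_sets[OF r] radon_measure_sigma_finite[OF r]])
      (simp_all add: locally_uniform_ball[OF assms])
  then show ?thesis
    by (intro integral_eq_nn_integral[THEN trans])
      (simp_all add: bump_nonneg borel_measurable_bump_power[OF radon_measure_sets[OF r]]
        borel_measurable_bump_power[OF radon_measure_sets[OF r], where n = 1, simplified])
qed

text \<open>By \<open>nn_integral_radial\<close> only the ball masses matter, and they agree at all
  support points. This invariance is what is expanded to second order below.\<close>

lemma integral_bump_3:
  assumes "locally_uniform k \<mu>" "x \<in> msupport \<mu>" "y \<in> msupport \<mu>"
  shows "(\<integral>u. bump x u ^ 3 \<partial>\<mu>) = (\<integral>u. bump y u ^ 3 \<partial>\<mu>)"
proof -
  note r = locally_uniform_radon[OF assms(1)]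
  have "(\<integral>\<^sup>+u. ennreal (bump x u ^ 3) \<partial>\<mu>) = (\<integral>\<^sup>+s. ennreal (2 * (real 2 + 1) * s * (1 - s\<^sup>2) ^ 2 *
    (unit_ball_vol k * s ^ k)) * indicator {0..1} s \<partial>lborel)" if "x \<in> msupport \<mu>" for x
    using nn_integral_radial[OF radon_measure_sets[OF r] radon_measure_sigma_finite[OF r]
        locally_uniform_ball[OF assms(1) that], of 2]
    unfolding bump_def by simp
  from this[OF assms(2)] this[OF assms(3)]
  have "(\<integral>\<^sup>+u. ennreal (bump x u ^ 3) \<partial>\<mu>) = (\<integral>\<^sup>+u. ennreal (bump y u ^ 3) \<partial>\<mu>)" by simp
  then show ?thesis
    by (subst (1 2) integral_eq_nn_integral)
      (simp_all add: bump_nonneg borel_measurable_bump_power[OF radon_measure_sets[OF r]]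
        borel_measurable_bump_power[OF radon_measure_sets[OF r], where n = 1, simplified])
qed

lemma integrable_bump_mult:
  fixes f :: "'a::euclidean_space \<Rightarrow> 'b::euclidean_space"
  assumes "radon_measure \<mu>" "continuous_on UNIV f"
  shows "integrable \<mu> (\<lambda>y. bump z y *\<^sub>R f y)"
proof -
  have "compact (f ` cball z 1)"
    by (intro compact_continuous_image continuous_on_subset[OF assms(2)]) auto
  then obtain C where C: "\<And>y. y \<in> cball z 1 \<Longrightarrow> norm (f y) \<le> C"
    using compact_imp_bounded by (fastforce simp: bounded_iff)
  show ?thesis
  proof (rule integrable_ball_support[OF assms(1), of _ z 1 C])
    show "continuous_on UNIV (\<lambda>y. bump z y *\<^sub>R f y)"
      by (intro continuous_intros assms)
    fix y assume "dist z y < 1"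
    then have "norm (f y) \<le> C" by (intro C) simp
    then show "norm (bump z y *\<^sub>R f y) \<le> C"
      using mult_left_le_one_le[OF norm_ge_zero[of "f y"] bump_nonneg bump_le_1, of z y] by (simp add: bump_nonneg)
  qed (simp add: bump_eq_0)
qed

lemma integrable_bump_mult_real:
  assumes "radon_measure \<mu>" "continuous_on UNIV f"
  shows "integrable \<mu> (\<lambda>y. bump z y * (f y :: real))"
  using integrable_bump_mult[OF assms] by simp

lemma integrable_bump_power:
  assumes "radon_measure \<mu>"
  shows "integrable \<mu> (\<lambda>y. bump z y ^ Suc n)"
  using integrable_bump_mult_real[OF assms, of "\<lambda>y. bump z y ^ n" z]
  by (auto intro!: continuous_intros)

section \<open>Moment identities along curves in the support\<close>

context
  fixes k :: nat and \<mu> :: "'a::euclidean_space measure" and z :: 'a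
  assumes unif: "locally_uniform k \<mu>" and z: "z \<in> msupport \<mu>"
begin

private lemma radon: "radon_measure \<mu>" using unif by (rule locally_uniform_radon)

text \<open>Coefficients of the expansion in \<open>h\<close>: shifting the centre by
  \<open>h\<close> changes the integral of the cubed weight by
  \<open>6 * inner h b + 12 * Q h - 3 * A * (norm h)\<^sup>2\<close>, up to an error of order
  three.\<close>

private definition "A = (\<integral>y. (bump z y)\<^sup>2 \<partial>\<mu>)"
private definition "b = (\<integral>y. (bump z y)\<^sup>2 *\<^sub>R (y - z) \<partial>\<mu>)"
private definition "Q h = (\<integral>y. bump z y * (inner h (y - z))\<^sup>2 \<partial>\<mu>)"

private lemma int_b: "integrable \<mu> (\<lambda>y. (bump z y)\<^sup>2 *\<^sub>R (y - z))"
  using integrable_bump_mult[OF radon, of "\<lambda>y. bump z y *\<^sub>R (y - z)" z]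
  by (simp add: power2_eq_square continuous_intros)

private lemma int_Q: "integrable \<mu> (\<lambda>y. bump z y * (inner h (y - z))\<^sup>2)"
  by (intro integrable_bump_mult_real[OF radon] continuous_intros)

private lemma int_2: "integrable \<mu> (\<lambda>y. (bump z y)\<^sup>2)"
  using integrable_bump_power[OF radon, of z 1] by (simp add: numeral_2_eq_2)

private lemma int_3: "integrable \<mu> (\<lambda>y. bump x y ^ 3)"
  using integrable_bump_power[OF radon, of x 2] by (simp add: numeral_3_eq_3)

text \<open>Integrate \<open>bump_expansion\<close>. Since \<open>z\<close> and \<open>z + h\<close>
  both lie in the support, the integrals of the two cubes cancel and only the moments
  remain.\<close>

private lemma moment_expansion:
  "\<exists>C. \<forall>h. norm h \<le> 1 \<longrightarrow> z + h \<in> msupport \<mu> \<longrightarrow>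
     \<bar>A * (norm h)\<^sup>2 - 2 * inner h b - 4 * Q h\<bar> \<le> C * norm h ^ 3"
proof (intro exI allI impI)
  fix h assume h: "norm h \<le> 1" "z + h \<in> msupport \<mu>"
  let ?f = "\<lambda>y. bump (z + h) y ^ 3 - bump z y ^ 3 + 3 * (norm h)\<^sup>2 * (bump z y)\<^sup>2
     - 6 * ((bump z y)\<^sup>2 * inner h (y - z)) - 12 * (bump z y * (inner h (y - z))\<^sup>2)"
  have ib: "integrable \<mu> (\<lambda>y. (bump z y)\<^sup>2 * inner h (y - z))"
    using integrable_inner_right[OF int_b, of h] by simp
  have b: "(\<integral>y. (bump z y)\<^sup>2 * inner h (y - z) \<partial>\<mu>) = inner h b"
    unfolding b_def using integral_inner_right[OF int_b, of h] by simp
  have int: "integrable \<mu> ?f"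
    by (intro Bochner_Integration.integrable_diff Bochner_Integration.integrable_add integrable_mult_right int_3 int_2 ib int_Q)
  have fin: "integrable \<mu> (\<lambda>y. 152 * norm h ^ 3 * indicator (ball z 2) y)"
    using radon_measure_finite_ball[OF radon] by (intro integrable_mult_right integrable_real_indicator) (simp_all add: radon_measure_sets[OF radon])
  have "(\<integral>y. ?f y \<partial>\<mu>) = (\<integral>y. bump (z + h) y ^ 3 \<partial>\<mu>) - (\<integral>y. bump z y ^ 3 \<partial>\<mu>) + 3 * (norm h)\<^sup>2 * A - 6 * inner h b - 12 * Q h"
    unfolding A_def Q_def b[symmetric]
    by (simp add: int_3 int_2 ib int_Q)
  also have "\<dots> = 3 * (A * (norm h)\<^sup>2 - 2 * inner h b - 4 * Q h)"
    using integral_bump_3[OF unif h(2) z] by simp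
  finally have "3 * \<bar>A * (norm h)\<^sup>2 - 2 * inner h b - 4 * Q h\<bar> = \<bar>\<integral>y. ?f y \<partial>\<mu>\<bar>"
    by (simp only: abs_mult abs_numeral)
  also have "\<dots> \<le> (\<integral>y. \<bar>?f y\<bar> \<partial>\<mu>)" by (rule integral_abs_bound)
  also have "\<dots> \<le> (\<integral>y. 152 * norm h ^ 3 * indicator (ball z 2) y \<partial>\<mu>)"
    by (intro integral_mono integrable_abs int fin bump_expansion h)
  also have "\<dots> = 152 * norm h ^ 3 * measure \<mu> (ball z 2)"
    by (simp add: sets_eq_imp_space_eq[OF radon_measure_sets[OF radon]])
  finally have "3 * \<bar>A * (norm h)\<^sup>2 - 2 * inner h b - 4 * Q h\<bar> \<le> 152 * norm h ^ 3 * measure \<mu> (ball z 2)" .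
  then have "\<bar>A * (norm h)\<^sup>2 - 2 * inner h b - 4 * Q h\<bar> \<le> 152 * norm h ^ 3 * measure \<mu> (ball z 2)"
    by (rule order_trans[rotated]) simp
  then show "\<bar>A * (norm h)\<^sup>2 - 2 * inner h b - 4 * Q h\<bar> \<le> 152 * measure \<mu> (ball z 2) * norm h ^ 3"
    by (simp add: mult_ac)
qed

private lemma Q_scale: "Q (t *\<^sub>R h) = t\<^sup>2 * Q h"
  unfolding Q_def integral_mult_right_zero[symmetric]
  by (intro Bochner_Integration.integral_cong) (simp_all add: power_mult_distrib mult_ac)

text \<open>\<open>Q\<close> is a quadratic form, so the difference of the squares factors through
  \<open>h - e\<close> and \<open>h + e\<close>, and the weight confines \<open>y\<close> to the
  unit ball. This yields the continuity of \<open>Q\<close> needed in the limits below.\<close>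

private lemma Q_diff: "\<bar>Q h - Q e\<bar> \<le> norm (h - e) * norm (h + e) * (\<integral>y. bump z y \<partial>\<mu>)"
proof -
  have i1: "integrable \<mu> (bump z)" using integrable_bump_power[OF radon, of z 0] by simp
  have "Q h - Q e = (\<integral>y. bump z y * (inner h (y - z))\<^sup>2 - bump z y * (inner e (y - z))\<^sup>2 \<partial>\<mu>)"
    unfolding Q_def by (simp add: int_Q)
  also have "\<bar>\<dots>\<bar> \<le> (\<integral>y. \<bar>bump z y * (inner h (y - z))\<^sup>2 - bump z y * (inner e (y - z))\<^sup>2\<bar> \<partial>\<mu>)"
    by (rule integral_abs_bound)
  also have "\<dots> \<le> (\<integral>y. norm (h - e) * norm (h + e) * bump z y \<partial>\<mu>)"
  proof (rule integral_mono)
    fix y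
    show "\<bar>bump z y * (inner h (y - z))\<^sup>2 - bump z y * (inner e (y - z))\<^sup>2\<bar> \<le> norm (h - e) * norm (h + e) * bump z y"
    proof (cases "dist z y < 1")
      case True
      have n: "norm (y - z) \<le> 1" using True by (simp add: dist_norm norm_minus_commute)
      have "\<bar>inner v (y - z)\<bar> \<le> norm v" for v
        using Cauchy_Schwarz_ineq2[of v "y - z"] mult_left_mono[OF n norm_ge_zero[of v]] by simp
      then have "\<bar>inner (h - e) (y - z) * inner (h + e) (y - z)\<bar> \<le> norm (h - e) * norm (h + e)"
        unfolding abs_mult by (intro mult_mono) auto
      moreover have "bump z y * (inner h (y - z))\<^sup>2 - bump z y * (inner e (y - z))\<^sup>2
          = inner (h - e) (y - z) * inner (h + e) (y - z) * bump z y"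
        by (simp add: inner_diff_left inner_add_left algebra_simps power2_eq_square)
      ultimately show ?thesis
        using mult_right_mono[OF _ bump_nonneg] by (simp add: abs_mult bump_nonneg)
    qed (simp add: bump_eq_0)
  qed (intro integrable_abs Bochner_Integration.integrable_diff int_Q integrable_mult_right i1)+
  also have "\<dots> = norm (h - e) * norm (h + e) * (\<integral>y. bump z y \<partial>\<mu>)" by simp
  finally show ?thesis .
qed

private lemma tendsto_Q: "(f \<longlongrightarrow> e) F \<Longrightarrow> ((\<lambda>t. Q (f t)) \<longlongrightarrow> Q e) F"
proof -
  assume f: "(f \<longlongrightarrow> e) F"
  have "((\<lambda>t. norm (f t - e) * norm (f t + e) * (\<integral>y. bump z y \<partial>\<mu>)) \<longlongrightarrow> norm (e - e) * norm (e + e) * (\<integral>y. bump z y \<partial>\<mu>)) F"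
    by (intro tendsto_intros f)
  then have "((\<lambda>t. norm (f t - e) * norm (f t + e) * (\<integral>y. bump z y \<partial>\<mu>)) \<longlongrightarrow> 0) F" by simp
  from Lim_null_comparison[OF _ this, of "\<lambda>t. Q (f t) - Q e"] Q_diff
  show ?thesis by (auto intro: LIM_zero_cancel)
qed

text \<open>The points in \<open>mem\<close> form a curve with velocity \<open>e\<close> and
  acceleration \<open>w\<close> at \<open>z\<close>. Inserted into \<open>moment_expansion\<close>,
  the order \<open>t\<close> gives the first identity and the order \<open>t\<^sup>2\<close> the
  second.\<close>

private lemma curve_moments:
  assumes r: "(r \<longlongrightarrow> w) (at 0)"
    and mem: "\<forall>\<^sub>F t in at 0. z + (t *\<^sub>R e + (t\<^sup>2 / 2) *\<^sub>R r t) \<in> msupport \<mu>"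
  shows "inner e b = 0" "A * (norm e)\<^sup>2 - inner w b - 4 * Q e = 0"
proof -
  \<comment> \<open>The displacement divided by \<open>t\<close>; it tends to \<open>e\<close>, so
    powers of \<open>t\<close> can be split off from every term.\<close>
  define g where "g t = e + (t / 2) *\<^sub>R r t" for t :: real
  have h: "t *\<^sub>R e + (t\<^sup>2 / 2) *\<^sub>R r t = t *\<^sub>R g t" for t
    by (simp add: g_def scaleR_add_right power2_eq_square)
  have "((\<lambda>t. e + (t / 2) *\<^sub>R r t) \<longlongrightarrow> e + (0 / 2) *\<^sub>R w) (at 0)"
    by (intro tendsto_intros r) auto
  then have g: "(g \<longlongrightarrow> e) (at 0)" by (simp add: g_def[abs_def])
  have "((\<lambda>t. norm (t *\<^sub>R g t)) \<longlongrightarrow> norm (0 *\<^sub>R e)) (at 0)"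
    by (intro tendsto_intros g)
  then have small: "\<forall>\<^sub>F t in at 0. norm (t *\<^sub>R g t) < 1"
    by (rule order_tendstoD) simp
  obtain C where C: "\<And>h. norm h \<le> 1 \<Longrightarrow> z + h \<in> msupport \<mu> \<Longrightarrow>
     \<bar>A * (norm h)\<^sup>2 - 2 * inner h b - 4 * Q h\<bar> \<le> C * norm h ^ 3"
    using moment_expansion by blast
  have ev: "\<forall>\<^sub>F t in at 0. t \<noteq> 0 \<and>
      \<bar>A * (norm (g t))\<^sup>2 * t\<^sup>2 - 2 * t * inner (g t) b - 4 * t\<^sup>2 * Q (g t)\<bar> \<le> C * \<bar>t\<bar> ^ 3 * norm (g t) ^ 3"
    using mem small eventually_neq_at_within[of 0 0 UNIV]
  proof eventually_elim
    case (elim t)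
    from C[of "t *\<^sub>R g t"] elim show ?case
      by (simp add: h Q_scale power_mult_distrib mult_ac)
  qed
  have "((\<lambda>t. A * (norm (g t))\<^sup>2 * t - 2 * inner (g t) b - 4 * t * Q (g t)) \<longlongrightarrow> A * (norm e)\<^sup>2 * 0 - 2 * inner e b - 4 * 0 * Q e) (at 0)"
    by (intro tendsto_intros g tendsto_Q)
  moreover have "((\<lambda>t. A * (norm (g t))\<^sup>2 * t - 2 * inner (g t) b - 4 * t * Q (g t)) \<longlongrightarrow> 0) (at 0)"
  proof (rule Lim_null_comparison)
    show "((\<lambda>t. C * \<bar>t\<bar> ^ 2 * norm (g t) ^ 3) \<longlongrightarrow> 0) (at 0)"
      by (rule tendsto_eq_intros g refl | simp)+
    show "\<forall>\<^sub>F t in at 0. norm (A * (norm (g t))\<^sup>2 * t - 2 * inner (g t) b - 4 * t * Q (g t)) \<le> C * \<bar>t\<bar> ^ 2 * norm (g t) ^ 3"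
      using ev
    proof eventually_elim
      case (elim t)
      have "\<bar>t\<bar> * norm (A * (norm (g t))\<^sup>2 * t - 2 * inner (g t) b - 4 * t * Q (g t)) =
        \<bar>A * (norm (g t))\<^sup>2 * t\<^sup>2 - 2 * t * inner (g t) b - 4 * t\<^sup>2 * Q (g t)\<bar>"
        unfolding real_norm_def abs_mult[symmetric] by (simp add: algebra_simps power2_eq_square)
      also have "\<dots> \<le> \<bar>t\<bar> * (C * \<bar>t\<bar> ^ 2 * norm (g t) ^ 3)"
        using elim by (simp add: power2_eq_square power3_eq_cube mult_ac)
      finally show ?case using elim by simp
    qed
  qed
  ultimately have "A * (norm e)\<^sup>2 * 0 - 2 * inner e b - 4 * 0 * Q e = 0"
    by (rule tendsto_unique[OF trivial_limit_at])
  then show eb: "inner e b = 0" by simp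
  have "((\<lambda>t. A * (norm (g t))\<^sup>2 - inner (r t) b - 4 * Q (g t)) \<longlongrightarrow> A * (norm e)\<^sup>2 - inner w b - 4 * Q e) (at 0)"
    by (intro tendsto_intros g r tendsto_Q)
  moreover have "((\<lambda>t. A * (norm (g t))\<^sup>2 - inner (r t) b - 4 * Q (g t)) \<longlongrightarrow> 0) (at 0)"
  proof (rule Lim_null_comparison)
    show "((\<lambda>t. C * \<bar>t\<bar> * norm (g t) ^ 3) \<longlongrightarrow> 0) (at 0)"
      by (rule tendsto_eq_intros g refl | simp)+
    show "\<forall>\<^sub>F t in at 0. norm (A * (norm (g t))\<^sup>2 - inner (r t) b - 4 * Q (g t)) \<le> C * \<bar>t\<bar> * norm (g t) ^ 3"
      using ev
    proof eventually_elim
      case (elim t)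
      \<comment> \<open>The first identity removes the leading part of this inner product. The extra
        factor \<open>t\<close> is what permits division by \<open>t\<^sup>2\<close>.\<close>
      have gb: "inner (g t) b = t / 2 * inner (r t) b"
        by (simp add: g_def inner_add_left eb)
      have "t\<^sup>2 * norm (A * (norm (g t))\<^sup>2 - inner (r t) b - 4 * Q (g t)) =
        \<bar>t\<^sup>2 * (A * (norm (g t))\<^sup>2 - inner (r t) b - 4 * Q (g t))\<bar>"
        by (simp add: abs_mult)
      also have "\<dots> = \<bar>A * (norm (g t))\<^sup>2 * t\<^sup>2 - 2 * t * inner (g t) b - 4 * t\<^sup>2 * Q (g t)\<bar>"
        unfolding gb by (simp add: algebra_simps power2_eq_square)
      also have "\<dots> \<le> \<bar>t\<bar> ^ 2 * (C * \<bar>t\<bar> * norm (g t) ^ 3)"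
        using elim by (simp add: power2_eq_square power3_eq_cube mult_ac)
      finally show ?case using elim by simp
    qed
  qed
  ultimately show "A * (norm e)\<^sup>2 - inner w b - 4 * Q e = 0"
    by (rule tendsto_unique[OF trivial_limit_at])
qed

text \<open>Hypothesis \<open>orth\<close> says that the accelerations sum to a vector without
  component normal to \<open>span E\<close>; it is applied to the moment \<open>b\<close>, which is
  normal by the first curve identity. Summing the second identity gives
  \<open>4 * (\<Sum>e\<in>E. Q e) = k * A\<close>, and comparison with the radial identity leaves a
  nonnegative integrand with integral 0.\<close>

lemma msupport_subset_plane:
  fixes E :: "'a set"
  assumes E: "finite E" "pairwise orthogonal E" "\<And>e. e \<in> E \<Longrightarrow> norm e = 1" "card E = k"
    and r: "\<And>e. e \<in> E \<Longrightarrow> (r e \<longlongrightarrow> w e) (at 0)"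
    and mem: "\<And>e. e \<in> E \<Longrightarrow> \<forall>\<^sub>F t in at 0. z + (t *\<^sub>R e + (t\<^sup>2 / 2) *\<^sub>R r e t) \<in> msupport \<mu>"
    and orth: "\<And>b. (\<And>e. e \<in> E \<Longrightarrow> inner e b = 0) \<Longrightarrow> inner (\<Sum>e\<in>E. w e) b = 0"
  shows "msupport \<mu> \<inter> ball z 1 \<subseteq> (+) z ` span E"
proof -
  have sets: "sets \<mu> = sets borel" using radon by (rule radon_measure_sets)
  note cm = curve_moments[OF r mem]
  have "inner (\<Sum>e\<in>E. w e) b = 0" using cm(1) by (intro orth)
  then have "(\<Sum>e\<in>E. inner (w e) b) = 0" by (simp add: inner_sum_left)
  moreover have "(\<Sum>e\<in>E. A - inner (w e) b - 4 * Q e) = (\<Sum>e\<in>E. 0)"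
    using cm(2) E(3) by (intro sum.cong) auto
  ultimately have sumQ: "4 * (\<Sum>e\<in>E. Q e) = k * A"
    by (simp add: sum_subtractf sum_distrib_left E(4))
  \<comment> \<open>The orthogonal projection of \<open>y - z\<close> onto \<open>span E\<close>;
    the goal is that \<open>y - z - p y\<close> vanishes on the support inside the unit
    ball.\<close>
  define p where "p y = (\<Sum>e\<in>E. inner e (y - z) *\<^sub>R e)" for y
  have bessel: "(norm (y - z - p y))\<^sup>2 = (norm (y - z))\<^sup>2 - (\<Sum>e\<in>E. (inner e (y - z))\<^sup>2)" for y
  proof -
    have "(norm (p y))\<^sup>2 = (\<Sum>e\<in>E. (inner e (y - z))\<^sup>2)"
      unfolding p_def using norm_sum_orthonormal[OF E(1-3), of "\<lambda>e. inner e (y - z)"] by (simp add: sum_nonneg)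
    moreover have "inner (y - z) (p y) = (\<Sum>e\<in>E. (inner e (y - z))\<^sup>2)"
      unfolding p_def inner_sum_right by (simp add: inner_commute power2_eq_square)
    moreover have "(norm (y - z - p y))\<^sup>2 = (norm (y - z))\<^sup>2 - 2 * inner (y - z) (p y) + (norm (p y))\<^sup>2"
      unfolding power2_norm_eq_inner by (simp add: inner_diff_left inner_diff_right inner_commute)
    ultimately show ?thesis by simp
  qed
  have cont_p: "continuous_on UNIV p" unfolding p_def by (intro continuous_intros)
  let ?f = "\<lambda>y. bump z y * (norm (y - z - p y))\<^sup>2"
  have int_f: "integrable \<mu> ?f"
    by (intro integrable_bump_mult_real[OF radon] continuous_intros cont_p)
  \<comment> \<open>Where the weight is positive, \<open>(norm (y - z))\<^sup>2\<close> is
    \<open>1 - bump z y\<close>, so the radial second moment is a difference of two integrals of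
    known value.\<close>
  have bump_norm: "bump z y * (norm (y - z))\<^sup>2 = bump z y - (bump z y)\<^sup>2" for y
    by (auto simp: bump_def max_def dist_norm norm_minus_commute power2_eq_square algebra_simps)
  have f_eq: "?f y = bump z y - (bump z y)\<^sup>2 - (\<Sum>e\<in>E. bump z y * (inner e (y - z))\<^sup>2)" for y
    unfolding bessel right_diff_distrib bump_norm sum_distrib_left ..
  have i1: "integrable \<mu> (bump z)" using integrable_bump_power[OF radon, of z 0] by simp
  have "(\<integral>y. ?f y \<partial>\<mu>) = (\<integral>y. bump z y \<partial>\<mu>) - A - (\<Sum>e\<in>E. Q e)"
    unfolding f_eq A_def Q_def by (simp add: int_2 int_Q i1)
  also have "\<dots> = 0"
  proof -
    have eq: "d * (c / (a * d)) = c / a" if "d \<noteq> 0" for a c d :: real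
      using that by simp
    have "4 * (\<integral>y. bump z y \<partial>\<mu>) = (k + 4) * A"
      unfolding A_def integral_bump_1[OF unif z] integral_bump_2[OF unif z] of_nat_mult
      by (subst eq) simp_all
    with sumQ show ?thesis by (simp add: algebra_simps)
  qed
  finally have "AE y in \<mu>. ?f y = 0"
    by (subst (asm) integral_nonneg_eq_0_iff_AE[OF int_f]) (auto simp: bump_nonneg)
  \<comment> \<open>The set where the integrand is positive is open by continuity; being null, it
    misses the support entirely.\<close>
  then have "AE y in \<mu>. y \<notin> {y. ?f y > 0}" by eventually_elim auto
  moreover have "open {y. ?f y > 0}"
    by (intro open_Collect_less continuous_intros cont_p)
  ultimately have f0: "{y. ?f y > 0} \<inter> msupport \<mu> = {}"
    using open_Int_msupport_empty[OF sets] by blast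
  show ?thesis
  proof
    fix y assume y: "y \<in> msupport \<mu> \<inter> ball z 1"
    then have "bump z y > 0" by (simp add: bump_pos_iff)
    moreover have "\<not> ?f y > 0" using f0 y by blast
    ultimately have "norm (y - z - p y) = 0" by (simp add: zero_less_mult_iff)
    then have "y = z + p y" by (simp add: algebra_simps)
    moreover have "p y \<in> span E"
      unfolding p_def by (intro span_sum span_scale span_base)
    ultimately show "y \<in> (+) z ` span E" by blast
  qed
qed

end

section \<open>Filling the plane\<close>

text \<open>Double counting of pairs at small distance, one point weighted by \<open>\<mu>\<close>
  and the other by the plane measure \<open>L\<close>. Normalised \<open>\<mu>\<close>-masses of
  small balls integrate over \<open>L\<close> to the \<open>L\<close>-measure of the support in the
  unit ball, in the limit; normalised \<open>L\<close>-masses integrate over \<open>\<mu>\<close> to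
  at least the full mass of that ball. As \<open>\<mu>\<close> and \<open>L\<close> agree on the
  unit ball, the support has full \<open>L\<close>-measure there.\<close>

lemma msupport_contains_plane_ball:
  fixes E :: "'a::euclidean_space set"
  assumes unif: "locally_uniform k \<mu>" and z: "z \<in> msupport \<mu>"
    and E: "finite E" "pairwise orthogonal E" "\<And>e. e \<in> E \<Longrightarrow> norm e = 1" "card E = k"
    and sub: "msupport \<mu> \<inter> ball z 1 \<subseteq> (+) z ` span E"
  shows "(+) z ` span E \<inter> ball z 1 \<subseteq> msupport \<mu>"
proof -
  note radon = locally_uniform_radon[OF unif]
  have sets: "sets \<mu> = sets borel" using radon by (rule radon_measure_sets)
  let ?S = "msupport \<mu>" and ?G = "ball z 1"
  let ?c = "unit_ball_vol (real k)"
  have c: "?c > 0" by simp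
  obtain L :: "'a measure" where L: "sets L = sets borel"
    and L_ball: "\<And>v r. v \<in> span E \<Longrightarrow> 0 < r \<Longrightarrow> emeasure L (ball (z + v) r) = ennreal (?c * r ^ k)"
    using exists_plane_measure[OF E(1-3), of z] unfolding E(4) by metis
  have L_ball0: "0 < r \<Longrightarrow> emeasure L (ball z r) = ennreal (?c * r ^ k)" for r
    using L_ball[of 0 r] by (simp add: span_zero)
  have "emeasure L (ball z (real n)) < \<infinity>" for n :: nat
    using L_ball0[of "real n"] by (cases "n = 0") auto
  then interpret L: sigma_finite_measure L using sigma_finite_measure_ball[OF L] by blast
  interpret mu: sigma_finite_measure \<mu> using radon by (rule radon_measure_sigma_finite)
  interpret pair_sigma_finite L \<mu> ..
  note [measurable_cong] = sets L
  have closed: "closed ?S" using sets by (rule closed_msupport)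
  have [measurable]: "?S \<in> sets borel" "?G \<in> sets borel" using closed by simp_all
  \<comment> \<open>Radii tending to 0, at most 1/2 so that \<open>locally_uniform_ball_le\<close>
    applies at every centre.\<close>
  define s :: "nat \<Rightarrow> real" where "s n = 1 / real (n + 2)" for n
  have s: "0 < s n" "s n \<le> 1/2" for n by (auto simp: s_def field_simps)
  have s0: "s \<longlonglongrightarrow> 0" unfolding s_def by (rule tendsto_1_over_n_plus_2)
  define d where "d n = ?c * s n ^ k" for n
  have d: "d n > 0" for n using s by (simp add: d_def)
  \<comment> \<open>\<open>d n\<close> is the common mass of balls of radius \<open>s n\<close> for
    both measures. Hence \<open>u n\<close> is exactly 1 on the part of the support in
    \<open>?G\<close>, and at a point off the support it is eventually 0.\<close>
  define u where "u n x = emeasure \<mu> (ball x (s n)) / ennreal (d n) * indicator ?G x" for n x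
  have [measurable]: "Measurable.pred (L \<Otimes>\<^sub>M \<mu>) (\<lambda>(x,y). dist x y < s n)" for n
    by measurable
  have meas_mu[measurable]: "(\<lambda>x. emeasure \<mu> (ball x (s n))) \<in> borel_measurable L" for n
  proof -
    have "(\<lambda>x. \<integral>\<^sup>+y. indicator {y. dist x y < s n} y \<partial>\<mu>) \<in> borel_measurable L"
      unfolding indicator_def mem_Collect_eq by measurable
    moreover have "(\<integral>\<^sup>+y. indicator {y. dist x y < s n} y \<partial>\<mu>) = emeasure \<mu> (ball x (s n))" for x
    proof -
      have "{y. dist x y < s n} = ball x (s n)" by auto
      then show ?thesis by (simp add: sets)
    qed
    ultimately show ?thesis by simp
  qed
  have u_meas[measurable]: "u n \<in> borel_measurable L" for n
  proof -
    have "(\<lambda>x. f x / ennreal (d n) * indicator ?G x) \<in> borel_measurable L" if "f \<in> borel_measurable L" for f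
      using that by measurable
    from this[OF meas_mu[of n]] show ?thesis by (simp add: u_def[abs_def])
  qed
  have lim_u: "(\<lambda>n. \<integral>\<^sup>+x. u n x \<partial>L) \<longlonglongrightarrow> (\<integral>\<^sup>+x. indicator (?S \<inter> ?G) x \<partial>L)"
  proof (rule nn_integral_dominated_convergence)
    show "(\<lambda>x. indicator (?S \<inter> ?G) x :: ennreal) \<in> borel_measurable L" by measurable
    show "(\<lambda>x. ennreal (2 ^ k) * indicator ?G x) \<in> borel_measurable L" by measurable
    show "AE x in L. u n x \<le> ennreal (2 ^ k) * indicator ?G x" for n
    proof (intro AE_I2)
      fix x
      \<comment> \<open>The dominating constant \<open>2 ^ k\<close> is the cost of doubling the
        radius at centres off the support.\<close>
      have "emeasure \<mu> (ball x (s n)) \<le> ennreal (?c * (2 * s n) ^ k)"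
        by (intro locally_uniform_ball_le[OF unif] s)
      also have "?c * (2 * s n) ^ k = 2 ^ k * d n" by (simp add: d_def power_mult_distrib)
      also have "ennreal (2 ^ k * d n) = ennreal (2 ^ k) * ennreal (d n)"
        using d[of n] by (simp add: ennreal_mult)
      finally have "emeasure \<mu> (ball x (s n)) / ennreal (d n) \<le> ennreal (2 ^ k)"
        using d[of n] by (subst divide_le_posI_ennreal) (auto simp: mult.commute)
      then show "u n x \<le> ennreal (2 ^ k) * indicator ?G x"
        by (auto simp: u_def indicator_def)
    qed
    have "(\<integral>\<^sup>+x. ennreal (2 ^ k) * indicator ?G x \<partial>L) = ennreal (2 ^ k) * emeasure L ?G"
      by (simp add: nn_integral_cmult_indicator L)
    also have "\<dots> < \<infinity>" using L_ball0[of 1] by (simp add: ennreal_mult_less_top)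
    finally show "(\<integral>\<^sup>+x. ennreal (2 ^ k) * indicator ?G x \<partial>L) < \<infinity>" .
    show "AE x in L. (\<lambda>n. u n x) \<longlonglongrightarrow> indicator (?S \<inter> ?G) x"
    proof (intro AE_I2)
      fix x
      have "\<forall>\<^sub>F n in sequentially. u n x = indicator (?S \<inter> ?G) x"
      proof (cases "x \<in> ?S")
        case True
        have "emeasure \<mu> (ball x (s n)) / ennreal (d n) = 1" for n
          using locally_uniform_ball[OF unif True, of "s n"] s[of n] d[of n]
          by (simp add: d_def[symmetric] divide_ennreal)
        then show ?thesis using True by (simp add: u_def indicator_def)
      next
        case False
        then obtain r where r: "r > 0" "emeasure \<mu> (ball x r) = 0"
          unfolding msupport_def by (auto simp: not_less)
        have "\<forall>\<^sub>F n in sequentially. s n < r" using order_tendstoD(2)[OF s0 r(1)] .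
        then show ?thesis
        proof eventually_elim
          case (elim n)
          have "emeasure \<mu> (ball x (s n)) \<le> emeasure \<mu> (ball x r)"
            using elim by (intro emeasure_mono) (auto simp: sets)
          then show ?case using r False by (simp add: u_def)
        qed
      qed
      then show "(\<lambda>n. u n x) \<longlonglongrightarrow> indicator (?S \<inter> ?G) x" by (rule tendsto_eventually)
    qed
  qed simp
  \<comment> \<open>The counterpart of \<open>u\<close> with the measures exchanged. Here both
    points of a pair are restricted to \<open>?G\<close>, while \<open>u\<close> leaves the
    \<open>\<mu>\<close>-point free; hence only an inequality between the integrals.\<close>
  define v where "v n y = emeasure L (ball y (s n) \<inter> ?G) / ennreal (d n) * indicator ?G y" for n y
  have v_u: "(\<integral>\<^sup>+y. v n y \<partial>\<mu>) \<le> (\<integral>\<^sup>+x. u n x \<partial>L)" for n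
  proof -
    let ?f = "\<lambda>x y. indicator {y. dist x y < s n} y * indicator ?G x * indicator ?G y / ennreal (d n)"
    have fm: "(\<lambda>(x,y). ?f x y) \<in> borel_measurable (L \<Otimes>\<^sub>M \<mu>)"
      unfolding indicator_def mem_Collect_eq by measurable
    have "(\<integral>\<^sup>+y. v n y \<partial>\<mu>) = (\<integral>\<^sup>+y. (\<integral>\<^sup>+x. ?f x y \<partial>L) \<partial>\<mu>)"
    proof (rule nn_integral_cong)
      fix y
      have "(\<integral>\<^sup>+x. ?f x y \<partial>L) = (\<integral>\<^sup>+x. indicator ?G y / ennreal (d n) * indicator (ball y (s n) \<inter> ?G) x \<partial>L)"
        by (intro nn_integral_cong) (auto simp: indicator_def dist_commute)
      also have "\<dots> = v n y"
        by (subst nn_integral_cmult_indicator) (auto simp: L v_def ennreal_divide_times mult_ac divide_ennreal_def)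
      finally show "v n y = (\<integral>\<^sup>+x. ?f x y \<partial>L)" by simp
    qed
    also have "\<dots> = (\<integral>\<^sup>+x. (\<integral>\<^sup>+y. ?f x y \<partial>\<mu>) \<partial>L)" by (rule Fubini'[OF fm])
    also have "\<dots> \<le> (\<integral>\<^sup>+x. u n x \<partial>L)"
    proof (rule nn_integral_mono)
      fix x
      have "(\<integral>\<^sup>+y. ?f x y \<partial>\<mu>) \<le> (\<integral>\<^sup>+y. indicator ?G x / ennreal (d n) * indicator (ball x (s n)) y \<partial>\<mu>)"
        by (intro nn_integral_mono) (auto simp: indicator_def)
      also have "\<dots> = u n x"
        by (subst nn_integral_cmult_indicator) (auto simp: sets u_def mult_ac divide_ennreal_def)
      finally show "(\<integral>\<^sup>+y. ?f x y \<partial>\<mu>) \<le> u n x" .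
    qed
    finally show ?thesis .
  qed
  have meas_L[measurable]: "(\<lambda>y. emeasure L (ball y (s n) \<inter> ?G)) \<in> borel_measurable \<mu>" for n
  proof -
    interpret P2: pair_sigma_finite \<mu> L ..
    have [measurable]: "Measurable.pred (\<mu> \<Otimes>\<^sub>M L) (\<lambda>(x,y). dist x y < s n)"
      by measurable
    have "(\<lambda>y. \<integral>\<^sup>+x. indicator {x. dist y x < s n} x * indicator ?G x \<partial>L) \<in> borel_measurable \<mu>"
      unfolding indicator_def mem_Collect_eq by measurable
    moreover have "(\<integral>\<^sup>+x. indicator {x. dist y x < s n} x * indicator ?G x \<partial>L) = emeasure L (ball y (s n) \<inter> ?G)" for y
    proof -
      have "(\<integral>\<^sup>+x. indicator {x. dist y x < s n} x * indicator ?G x \<partial>L) = (\<integral>\<^sup>+x. indicator (ball y (s n) \<inter> ?G) x \<partial>L)"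
        by (intro nn_integral_cong) (auto simp: indicator_def)
      then show ?thesis by (simp add: L)
    qed
    ultimately show ?thesis by simp
  qed
  have v_meas[measurable]: "v n \<in> borel_measurable \<mu>" for n
  proof -
    have "(\<lambda>x. f x / ennreal (d n) * indicator ?G x) \<in> borel_measurable \<mu>" if "f \<in> borel_measurable \<mu>" for f
      using that by measurable
    from this[OF meas_L[of n]] show ?thesis by (simp add: v_def[abs_def])
  qed
  have "emeasure \<mu> ?G = (\<integral>\<^sup>+y. indicator ?G y \<partial>\<mu>)" by (simp add: sets)
  also have "\<dots> \<le> (\<integral>\<^sup>+y. liminf (\<lambda>n. v n y) \<partial>\<mu>)"
  proof (rule nn_integral_mono_AE)
    show "AE y in \<mu>. indicator ?G y \<le> liminf (\<lambda>n. v n y)"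
      using AE_in_msupport[OF sets]
    proof eventually_elim
      case (elim y)
      show ?case
      proof (cases "y \<in> ?G")
        case True
        \<comment> \<open>Here \<open>sub\<close> enters: almost every \<open>y\<close> in
          \<open>?G\<close> lies on the plane, where \<open>L\<close>-balls of radius
          \<open>s n\<close> have mass \<open>d n\<close>. Once \<open>s n < 1 - dist z y\<close>
          such a ball stays inside \<open>?G\<close>, and \<open>v n y\<close> is 1.\<close>
        then obtain w where w: "w \<in> span E" "y = z + w" using sub elim by blast
        have "1 - dist z y > 0" using True by simp
        from order_tendstoD(2)[OF s0 this] have "\<forall>\<^sub>F n in sequentially. v n y = 1"
        proof eventually_elim
          case (elim n)
          have "ball y (s n) \<subseteq> ?G"
          proof
            fix x assume "x \<in> ball y (s n)"
            with elim dist_triangle[of z x y] show "x \<in> ?G" by simp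
          qed
          then have "ball y (s n) \<inter> ?G = ball y (s n)" by blast
          then show ?case using True d[of n] s[of n] L_ball[OF w(1), of "s n"]
            by (simp add: v_def w(2) d_def[symmetric] divide_ennreal)
        qed
        then have "(\<lambda>n. v n y) \<longlonglongrightarrow> 1" by (rule tendsto_eventually)
        then have "liminf (\<lambda>n. v n y) = 1" by (intro lim_imp_Liminf) auto
        with True show ?thesis by simp
      qed simp
    qed
  qed
  also have "\<dots> \<le> liminf (\<lambda>n. \<integral>\<^sup>+y. v n y \<partial>\<mu>)"
    by (intro nn_integral_liminf v_meas)
  also have "\<dots> \<le> liminf (\<lambda>n. \<integral>\<^sup>+x. u n x \<partial>L)"
    by (intro Liminf_mono always_eventually allI v_u)
  also have "\<dots> = (\<integral>\<^sup>+x. indicator (?S \<inter> ?G) x \<partial>L)"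
    using lim_u by (intro lim_imp_Liminf) auto
  also have "\<dots> = emeasure L (?S \<inter> ?G)" by (intro nn_integral_indicator) measurable
  finally have le: "emeasure \<mu> ?G \<le> emeasure L (?S \<inter> ?G)" .
  have "emeasure \<mu> ?G = emeasure L ?G"
    using L_ball0[of 1] locally_uniform_ball[OF unif z, of 1] by simp
  also have "emeasure L ?G = emeasure L (?S \<inter> ?G) + emeasure L (?G - ?S)"
    by (subst plus_emeasure) (auto simp: L intro!: arg_cong[of _ _ "emeasure L"])
  finally have "emeasure L (?S \<inter> ?G) + emeasure L (?G - ?S) \<le> emeasure L (?S \<inter> ?G) + 0"
    using le by simp
  moreover have "emeasure L (?S \<inter> ?G) \<noteq> top"
    using emeasure_mono[of "?S \<inter> ?G" ?G L] L_ball0[of 1] by (auto simp: L top_unique)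
  ultimately have null: "emeasure L (?G - ?S) = 0"
    by (simp only: ennreal_add_left_cancel_le) simp
  show ?thesis
  proof
    fix p assume p: "p \<in> (+) z ` span E \<inter> ?G"
    show "p \<in> ?S"
    \<comment> \<open>Off the closed support, \<open>p\<close> would have a whole ball inside the
      \<open>L\<close>-null set \<open>?G - ?S\<close>, but balls centred on the plane have positive
      \<open>L\<close>-mass.\<close>
    proof (rule ccontr)
      assume "p \<notin> ?S"
      with p closed have "open (?G - ?S)" "p \<in> ?G - ?S" by auto
      then obtain r where r: "r > 0" "ball p r \<subseteq> ?G - ?S" using openE by blast
      then have "emeasure L (ball p r) = 0"
        using emeasure_mono[OF r(2), of L] null by (simp add: L)
      moreover obtain w where "w \<in> span E" "p = z + w" using p by blast
      ultimately show False using L_ball[of w r] r c by simp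
    qed
  qed
qed

section \<open>Propagation of flatness along the plane\<close>

lemma flat_point_step:
  fixes E :: "'a::euclidean_space set"
  assumes unif: "locally_uniform k \<mu>"
    and E: "finite E" "pairwise orthogonal E" "\<And>e. e \<in> E \<Longrightarrow> norm e = 1" "card E = k"
    and x: "x \<in> msupport \<mu>" and loc: "\<epsilon> > 0" "(+) x ` span E \<inter> ball x \<epsilon> \<subseteq> msupport \<mu>"
  shows "msupport \<mu> \<inter> ball x 1 = (+) x ` span E \<inter> ball x 1"
proof -
  have "msupport \<mu> \<inter> ball x 1 \<subseteq> (+) x ` span E"
  \<comment> \<open>Straight lines serve as curves: near \<open>x\<close> they stay in the support
    and have zero acceleration, so the condition on the sum of the accelerations is immediate.
    Flatness at scale \<open>\<epsilon>\<close> thus improves to scale 1.\<close>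
  proof (rule msupport_subset_plane[OF unif x E, where r = "\<lambda>_ _. 0" and w = "\<lambda>_. 0"])
    fix e assume e: "e \<in> E"
    have "\<forall>\<^sub>F t in at 0. dist t 0 < \<epsilon>" using loc(1) by (auto simp: eventually_at)
    then show "\<forall>\<^sub>F t in at 0. x + (t *\<^sub>R e + (t\<^sup>2 / 2) *\<^sub>R 0) \<in> msupport \<mu>"
    proof eventually_elim
      case (elim t)
      then have "x + t *\<^sub>R e \<in> (+) x ` span E \<inter> ball x \<epsilon>"
        using E(3)[OF e] span_scale[OF span_base[OF e]] by (auto simp: dist_norm)
      then show ?case using loc(2) by auto
    qed
  qed auto
  with msupport_contains_plane_ball[OF unif x E] show ?thesis by blast
qed

lemma translate_subspace_eq:
  assumes "subspace V" "x \<in> (+) z ` V"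
  shows "(+) x ` V = (+) z ` V"
proof -
  obtain v where v: "v \<in> V" "x = z + v" using assms(2) by blast
  have "V = (+) v ` V"
  proof (intro set_eqI iffI)
    fix u assume "u \<in> V"
    then have "u - v \<in> V" using assms(1) v(1) by (intro subspace_diff)
    then have "v + (u - v) \<in> (+) v ` V" by (intro imageI)
    then show "u \<in> (+) v ` V" by simp
  qed (use subspace_add[OF assms(1) v(1)] in blast)
  then have "(+) z ` V = (+) z ` (+) v ` V" by simp
  also have "\<dots> = (+) x ` V" by (simp add: image_image v(2) add.assoc)
  finally show ?thesis by simp
qed

text \<open>Flatness in one unit ball passes to the unit balls around all plane points in it, and
  along chains to the whole plane. The support then contains the plane and has no further point
  within distance 1 of it, which makes the plane closed and relatively open in the
  component.\<close>

lemma flat_component: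
  fixes E :: "'a::euclidean_space set"
  assumes unif: "locally_uniform k \<mu>" and z: "z \<in> msupport \<mu>"
    and E: "finite E" "pairwise orthogonal E" "\<And>e. e \<in> E \<Longrightarrow> norm e = 1" "card E = k"
    and flat: "msupport \<mu> \<inter> ball z 1 = (+) z ` span E \<inter> ball z 1"
  shows "k_plane k (connected_component_set (msupport \<mu>) z)"
proof -
  let ?S = "msupport \<mu>"
  define P where "P = (+) z ` span E"
  have P_eq: "(+) x ` span E = P" if "x \<in> P" for x
  proof -
    have "x \<in> (+) z ` span E" using that by (simp only: P_def)
    from translate_subspace_eq[OF subspace_span this] show ?thesis by (simp only: P_def)
  qed
  have step: "?S \<inter> ball y 1 = P \<inter> ball y 1"
    if x: "x \<in> P" and S: "?S \<inter> ball x 1 = P \<inter> ball x 1" and y: "y \<in> P" "dist x y < 1" for x y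
  proof -
    have "y \<in> P \<inter> ball x 1" using y by simp
    then have yS: "y \<in> ?S" unfolding S[symmetric] by blast
    have pos: "1 - dist x y > 0" using y by simp
    have sub: "(+) y ` span E \<inter> ball y (1 - dist x y) \<subseteq> ?S"
    proof
      fix u assume u: "u \<in> (+) y ` span E \<inter> ball y (1 - dist x y)"
      then have "u \<in> P" "dist y u < 1 - dist x y" unfolding P_eq[OF y(1)] by simp_all
      then have "u \<in> P \<inter> ball x 1" using dist_triangle[of x u y] by simp
      with S show "u \<in> ?S" by blast
    qed
    show ?thesis using flat_point_step[OF unif E yS pos sub] by (simp only: P_eq[OF y(1)])
  qed
  have z_P: "z \<in> P" unfolding P_def using span_zero by force
  have all: "?S \<inter> ball x 1 = P \<inter> ball x 1" if x: "x \<in> P" for x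
  proof -
    obtain v where v: "v \<in> span E" "x = z + v" using x unfolding P_def by blast
    \<comment> \<open>Walk from \<open>z\<close> to \<open>x\<close> in \<open>m\<close> equal
      steps; the choice \<open>m > norm v\<close> makes each step shorter than 1.\<close>
    obtain m :: nat where m: "norm v < real m" using reals_Archimedean2 by blast
    then have m0: "0 < real m" using norm_ge_zero[of v] by linarith
    let ?x = "\<lambda>i. z + (real i / real m) *\<^sub>R v"
    have xP: "?x i \<in> P" for i unfolding P_def using v by (intro imageI span_scale)
    have "?S \<inter> ball (?x i) 1 = P \<inter> ball (?x i) 1" for i
    proof (induction i)
      case 0
      then show ?case using flat by (simp add: P_def)
    next
      case (Suc i)
      have "?x i - ?x (Suc i) = - (1 / real m) *\<^sub>R v"
        by (simp add: algebra_simps add_divide_distrib)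
      then have "dist (?x i) (?x (Suc i)) < 1" using m m0 by (simp add: dist_norm)
      with step[OF xP Suc xP] show ?case by blast
    qed
    from this[of m] show ?thesis using m0 v by simp
  qed
  have P_sub: "P \<subseteq> ?S"
  proof
    fix x assume "x \<in> P"
    moreover have "x \<in> ball x 1" by simp
    ultimately show "x \<in> ?S" using all[of x] by blast
  qed
  have aff: "affine P" unfolding P_def by (simp add: affine_translation[symmetric] subspace_imp_affine)
  let ?C = "connected_component_set ?S z"
  have "P \<subseteq> ?C"
    using z_P P_sub convex_connected[OF affine_imp_convex[OF aff]] by (intro connected_component_maximal)
  moreover have "?C \<subseteq> P"
  proof -
    have "open (\<Union>x\<in>P. ball x 1)" by blast
    moreover have "(\<Union>x\<in>P. ball x 1) \<inter> ?C = P \<inter> ?C"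
    proof (intro set_eqI iffI)
      fix u assume u: "u \<in> (\<Union>x\<in>P. ball x 1) \<inter> ?C"
      then obtain x where x: "x \<in> P" "u \<in> ball x 1" by blast
      have "u \<in> ?S" using u connected_component_subset[of ?S z] by blast
      with x all[OF x(1)] have "u \<in> P" by blast
      with u show "u \<in> P \<inter> ?C" by blast
    next
      fix u assume "u \<in> P \<inter> ?C"
      moreover have "u \<in> ball u 1" by simp
      ultimately show "u \<in> (\<Union>x\<in>P. ball x 1) \<inter> ?C" by blast
    qed
    ultimately have "openin (top_of_set ?C) (P \<inter> ?C)"
      by (metis inf_commute openin_open_Int)
    moreover have "closedin (top_of_set ?C) (P \<inter> ?C)"
      using affine_closed[OF aff] by (metis closedin_closed_Int inf_commute)
    ultimately have "P \<inter> ?C = {} \<or> P \<inter> ?C = ?C"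
      using connected_connected_component[of ?S z] by (auto simp: connected_clopen)
    moreover have "z \<in> P \<inter> ?C" using z_P z by simp
    ultimately show ?thesis by blast
  qed
  ultimately have "?C = P" by blast
  moreover have "aff_dim P = int k"
  proof -
    have "0 \<notin> E" using E(3) by fastforce
    then have "independent E" using E(2) by (intro pairwise_orthogonal_independent)
    then have "dim (span E) = k" by (simp add: dim_eq_card_independent E(4))
    then show ?thesis
      unfolding P_def aff_dim_translation_eq by (simp add: aff_dim_subspace)
  qed
  ultimately show ?thesis using aff by (simp add: k_plane_def)
qed

section \<open>The second fundamental form of a graph\<close>

text \<open>Subtracting \<open>(s\<^sup>2 / 2) *\<^sub>R w\<close> from \<open>g\<close> leaves a
  function whose derivative stays within \<open>(\<epsilon> / 4) * \<bar>s\<bar>\<close> of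
  \<open>g' 0\<close>; the mean value inequality on the segment from 0 to \<open>t\<close> gives the
  rest. Differentiability of \<open>g'\<close> is used at 0 alone.\<close>

lemma second_order_expansion:
  fixes g :: "real \<Rightarrow> 'a::real_normed_vector"
  assumes "\<delta> > 0" and g: "\<And>t. \<bar>t\<bar> < \<delta> \<Longrightarrow> (g has_vector_derivative g' t) (at t)"
    and g': "(g' has_vector_derivative w) (at 0)"
  shows "((\<lambda>t. (2 / t\<^sup>2) *\<^sub>R (g t - g 0 - t *\<^sub>R g' 0)) \<longlongrightarrow> w) (at 0)"
proof (rule tendstoI)
  fix \<epsilon> :: real assume \<epsilon>: "\<epsilon> > 0"
  have "\<forall>e>0. \<exists>d>0. \<forall>s. norm (s - 0) < d \<longrightarrow> norm (g' s - g' 0 - (s - 0) *\<^sub>R w) \<le> e * norm (s - 0)"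
    using g'[unfolded has_vector_derivative_def has_derivative_at_alt] by (rule conjunct2)
  from this[rule_format, of "\<epsilon> / 4"] \<epsilon> obtain d where d: "d > 0"
    and bound': "\<And>s. norm (s - 0) < d \<Longrightarrow> norm (g' s - g' 0 - (s - 0) *\<^sub>R w) \<le> (\<epsilon> / 4) * norm (s - 0)"
    by (meson zero_less_divide_iff zero_less_numeral)
  have bound: "norm (g' s - g' 0 - s *\<^sub>R w) \<le> (\<epsilon> / 4) * \<bar>s\<bar>" if "\<bar>s\<bar> < d" for s
    using bound'[of s] that by simp
  have "\<forall>\<^sub>F t in at 0. t \<noteq> 0 \<and> \<bar>t\<bar> < min d \<delta>"
    using d \<open>\<delta> > 0\<close> unfolding eventually_at by (intro exI[of _ "min d \<delta>"]) auto
  then show "\<forall>\<^sub>F t in at 0. dist ((2 / t\<^sup>2) *\<^sub>R (g t - g 0 - t *\<^sub>R g' 0)) w < \<epsilon>"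
  proof eventually_elim
    case (elim t)
    have seg: "\<bar>s\<bar> \<le> \<bar>t\<bar>" if "s \<in> closed_segment 0 t" for s
      using that by (auto simp: closed_segment_eq_real_ivl split: if_splits)
    define f where "f s = g s - (s\<^sup>2 / 2) *\<^sub>R w" for s
    have "norm (f t - f 0 - (t - 0) *\<^sub>R (g' 0 - 0 *\<^sub>R w)) \<le> norm (t - 0) * ((\<epsilon> / 4) * \<bar>t\<bar>)"
    proof (rule vector_differentiable_bound_linearization[where S = "closed_segment 0 t" and f' = "\<lambda>s. g' s - s *\<^sub>R w"])
      fix s assume s: "s \<in> closed_segment 0 t"
      then have "(g has_vector_derivative g' s) (at s)" using seg[OF s] elim by (intro g) simp
      then have "(f has_vector_derivative g' s - s *\<^sub>R w) (at s)"
        unfolding f_def by (auto intro!: derivative_eq_intros simp: field_simps)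
      then show "(f has_vector_derivative g' s - s *\<^sub>R w) (at s within closed_segment 0 t)"
        by (rule has_vector_derivative_at_within)
      have "norm (g' s - g' 0 - s *\<^sub>R w) \<le> (\<epsilon> / 4) * \<bar>s\<bar>" using seg[OF s] elim by (intro bound) simp
      also have "\<dots> \<le> (\<epsilon> / 4) * \<bar>t\<bar>" using seg[OF s] \<epsilon> by simp
      finally show "norm ((g' s - s *\<^sub>R w) - (g' 0 - 0 *\<^sub>R w)) \<le> (\<epsilon> / 4) * \<bar>t\<bar>"
        by (simp add: algebra_simps)
    qed auto
    then have R: "norm (g t - g 0 - t *\<^sub>R g' 0 - (t\<^sup>2 / 2) *\<^sub>R w) \<le> t\<^sup>2 * (\<epsilon> / 4)"
      by (simp add: f_def algebra_simps power2_eq_square abs_mult_self_eq)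
    have "(2 / t\<^sup>2) *\<^sub>R (g t - g 0 - t *\<^sub>R g' 0) - w = (2 / t\<^sup>2) *\<^sub>R (g t - g 0 - t *\<^sub>R g' 0 - (t\<^sup>2 / 2) *\<^sub>R w)"
      using elim by (simp add: scaleR_diff_right)
    then have "dist ((2 / t\<^sup>2) *\<^sub>R (g t - g 0 - t *\<^sub>R g' 0)) w = (2 / t\<^sup>2) * norm (g t - g 0 - t *\<^sub>R g' 0 - (t\<^sup>2 / 2) *\<^sub>R w)"
      by (simp add: dist_norm)
    also have "\<dots> \<le> (2 / t\<^sup>2) * (t\<^sup>2 * (\<epsilon> / 4))" by (intro mult_left_mono R) simp
    also have "\<dots> < \<epsilon>" using elim \<epsilon> by simp
    finally show ?case .
  qed
qed

section \<open>Orthogonal projections and traces in orthonormal bases\<close>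

lemma orth_proj_eqI:
  fixes N :: "'a::euclidean_space set"
  assumes "subspace N" "p \<in> N" "w - p \<in> N\<^sup>\<bottom>"
  shows "orth_proj N w = p"
  unfolding orth_proj_def
proof (rule the_equality)
  fix q assume q: "q \<in> N \<and> w - q \<in> N\<^sup>\<bottom>"
  then have "q - p \<in> N" using assms by (simp add: subspace_diff)
  moreover have "(w - p) - (w - q) \<in> N\<^sup>\<bottom>"
    by (rule subspace_diff[OF subspace_orthogonal_comp assms(3)]) (use q in simp)
  then have "q - p \<in> N\<^sup>\<bottom>" by simp
  ultimately show "q = p"
    using orthogonal_Int_0[OF assms(1)] by (metis IntI eq_iff_diff_eq_0 singletonD)
qed (use assms in auto)

lemma orth_proj_props:
  fixes N :: "'a::euclidean_space set"
  assumes "subspace N"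
  shows orth_proj_in: "orth_proj N w \<in> N" and orth_proj_diff: "w - orth_proj N w \<in> N\<^sup>\<bottom>"
proof -
  have "w \<in> N + N\<^sup>\<bottom>" using subspace_sum_orthogonal_comp[OF assms] by simp
  then obtain p q where "p \<in> N" "q \<in> N\<^sup>\<bottom>" "w = p + q" by (auto elim: set_plus_elim)
  then have "orth_proj N w = p" "p \<in> N" "w - p \<in> N\<^sup>\<bottom>"
    by (auto intro!: orth_proj_eqI assms)
  then show "orth_proj N w \<in> N" "w - orth_proj N w \<in> N\<^sup>\<bottom>" by simp_all
qed

lemma orth_proj_id: "subspace N \<Longrightarrow> w \<in> N \<Longrightarrow> orth_proj N w = w"
  for N :: "'a::euclidean_space set"
  by (intro orth_proj_eqI) (auto simp: subspace_0 subspace_orthogonal_comp)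

lemma orth_proj_orthogonal: "subspace N \<Longrightarrow> w \<in> N\<^sup>\<bottom> \<Longrightarrow> orth_proj N w = 0"
  for N :: "'a::euclidean_space set"
  by (intro orth_proj_eqI) (auto simp: subspace_0)

lemma linear_orth_proj:
  fixes N :: "'a::euclidean_space set"
  assumes "subspace N"
  shows "linear (orth_proj N)"
proof
  note p = orth_proj_in[OF assms] orth_proj_diff[OF assms]
  fix v w :: 'a and c :: real
  show "orth_proj N (v + w) = orth_proj N v + orth_proj N w"
  proof (rule orth_proj_eqI[OF assms])
    show "orth_proj N v + orth_proj N w \<in> N" by (intro subspace_add assms p)
    have "(v - orth_proj N v) + (w - orth_proj N w) \<in> N\<^sup>\<bottom>"
      by (intro subspace_add subspace_orthogonal_comp p)
    then show "v + w - (orth_proj N v + orth_proj N w) \<in> N\<^sup>\<bottom>" by (simp add: algebra_simps)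
  qed
  show "orth_proj N (c *\<^sub>R w) = c *\<^sub>R orth_proj N w"
  proof (rule orth_proj_eqI[OF assms])
    show "c *\<^sub>R orth_proj N w \<in> N" by (intro subspace_scale assms p)
    have "c *\<^sub>R (w - orth_proj N w) \<in> N\<^sup>\<bottom>"
      by (intro subspace_scale subspace_orthogonal_comp p)
    then show "c *\<^sub>R w - c *\<^sub>R orth_proj N w \<in> N\<^sup>\<bottom>" by (simp add: algebra_simps)
  qed
qed

lemma orthonormal_expansion:
  fixes E :: "'a::euclidean_space set"
  assumes "orthonormal_basis_of V E" "x \<in> V"
  shows "x = (\<Sum>e\<in>E. inner e x *\<^sub>R e)"
proof -
  have E: "pairwise orthogonal E" "\<And>e. e \<in> E \<Longrightarrow> norm e = 1" "span E = V"
    using assms(1) by (auto simp: orthonormal_basis_of_def)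
  have "0 \<notin> E" using E(2) by fastforce
  then have fin: "finite E" using E by (intro independent_imp_finite pairwise_orthogonal_independent)
  obtain a where a: "x = (\<Sum>e\<in>E. a e *\<^sub>R e)" using assms(2) E(3) span_finite[OF fin] by auto
  have "inner e x = a e" if e: "e \<in> E" for e
  proof -
    have "inner e x = (\<Sum>f\<in>E. a f * inner e f)" by (simp add: a inner_sum_right)
    also have "\<dots> = (\<Sum>f\<in>E. if f = e then a e else 0)"
      using E(1) E(2)[OF e] e by (intro sum.cong) (auto simp: pairwise_def orthogonal_def norm_eq_1)
    finally show ?thesis using fin e by simp
  qed
  then show ?thesis using a by simp
qed

lemma orthonormal_basis_of_props:
  fixes E :: "'a::euclidean_space set"
  assumes "orthonormal_basis_of V E"
  shows "finite E" "card E = dim V" "pairwise orthogonal E" "\<And>e. e \<in> E \<Longrightarrow> norm e = 1" "span E = V" "E \<subseteq> V"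
proof -
  have E: "pairwise orthogonal E" "\<And>e. e \<in> E \<Longrightarrow> norm e = 1" "span E = V"
    using assms by (auto simp: orthonormal_basis_of_def)
  have "0 \<notin> E" using E(2) by fastforce
  then have "independent E" using E by (intro pairwise_orthogonal_independent)
  then show "finite E" "card E = dim V"
    unfolding E(3)[symmetric] by (simp_all add: independent_imp_finite dim_eq_card_independent)
  show "pairwise orthogonal E" "\<And>e. e \<in> E \<Longrightarrow> norm e = 1" "span E = V" "E \<subseteq> V"
    using E span_superset[of E] by auto
qed

text \<open>Expand each \<open>e\<close> in the basis \<open>F\<close>, swap the sums and collect in
  \<open>E\<close>. This makes the definite description in \<open>mean_curvature_vector\<close> well
  defined.\<close>

lemma trace_orthonormal_basis_unique:
  fixes \<beta> :: "'a::euclidean_space \<Rightarrow> 'a \<Rightarrow> 'b::real_vector"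
  assumes E: "orthonormal_basis_of V E" and F: "orthonormal_basis_of V F"
    and lin1: "\<And>v. linear (\<lambda>u. \<beta> u v)" and lin2: "\<And>u. linear (\<beta> u)"
  shows "(\<Sum>e\<in>E. \<beta> e e) = (\<Sum>f\<in>F. \<beta> f f)"
proof -
  note EV = orthonormal_basis_of_props(6)[OF E] and FV = orthonormal_basis_of_props(6)[OF F]
  have "(\<Sum>e\<in>E. \<beta> e e) = (\<Sum>e\<in>E. \<Sum>f\<in>F. inner f e *\<^sub>R \<beta> f e)"
  proof (rule sum.cong[OF refl])
    fix e assume "e \<in> E"
    then have "e = (\<Sum>f\<in>F. inner f e *\<^sub>R f)" using orthonormal_expansion[OF F] EV by blast
    then have "\<beta> e e = \<beta> (\<Sum>f\<in>F. inner f e *\<^sub>R f) e" by simp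
    also have "\<dots> = (\<Sum>f\<in>F. inner f e *\<^sub>R \<beta> f e)"
      using linear_sum[OF lin1, of "\<lambda>f. inner f e *\<^sub>R f" F e] by (simp add: linear_scale[OF lin1])
    finally show "\<beta> e e = (\<Sum>f\<in>F. inner f e *\<^sub>R \<beta> f e)" .
  qed
  also have "\<dots> = (\<Sum>f\<in>F. \<Sum>e\<in>E. inner f e *\<^sub>R \<beta> f e)" by (rule sum.swap)
  also have "\<dots> = (\<Sum>f\<in>F. \<beta> f f)"
  proof (rule sum.cong[OF refl])
    fix f assume "f \<in> F"
    then have f: "f = (\<Sum>e\<in>E. inner f e *\<^sub>R e)"
      using orthonormal_expansion[OF E, of f] FV by (auto simp: inner_commute)
    have "(\<Sum>e\<in>E. inner f e *\<^sub>R \<beta> f e) = \<beta> f (\<Sum>e\<in>E. inner f e *\<^sub>R e)"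
      by (simp add: linear_sum[OF lin2] linear_scale[OF lin2])
    with f show "(\<Sum>e\<in>E. inner f e *\<^sub>R \<beta> f e) = \<beta> f f" by simp
  qed
  finally show ?thesis .
qed

section \<open>Tangent space and second fundamental form of a C2 graph\<close>

lemma has_vector_derivative_eventually_unique:
  assumes f: "(f has_vector_derivative a) (at t)" and g: "(g has_vector_derivative b) (at t)"
    and eq: "\<forall>\<^sub>F s in nhds t. f s = g s"
  shows "a = b"
proof -
  have "(g has_vector_derivative a) (at t)"
    using f unfolding has_vector_derivative_def
  proof (rule has_derivative_transform_eventually)
    show "\<forall>\<^sub>F s in at t. f s = g s" using eq by (auto simp: eventually_at_filter elim: eventually_mono)
    show "f t = g t" using eq by (rule eventually_nhds_x_imp_x)
  qed simp
  then show ?thesis using g vector_derivative_unique_at by blast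
qed

lemma has_vector_derivative_compose_at:
  assumes "(f has_vector_derivative v) (at t)" "(g has_derivative g') (at y)" "f t = y"
  shows "((\<lambda>t. g (f t)) has_vector_derivative g' v) (at t)"
proof -
  have "(g has_derivative g') (at (f t) within range f)"
    unfolding assms(3) by (rule has_derivative_at_withinI[OF assms(2)])
  from vector_derivative_diff_chain_within[OF assms(1) this] show ?thesis
    unfolding o_def .
qed

text \<open>Unpacks \<open>C2_submanifold_near\<close> with both derivatives fixed. Only on
  \<open>T \<inter> W\<close> is \<open>\<phi>\<close> tied to the set \<open>M\<close> and to the
  orthogonal complement of \<open>T\<close>, so the geometric arguments run along lines in
  \<open>T\<close>; the projection \<open>P\<close> recovers the parameter of a graph point.\<close>

locale C2_graph =
  fixes T U W M :: "'a::euclidean_space set" and \<phi> :: "'a \<Rightarrow> 'a"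
    and \<phi>' :: "'a \<Rightarrow> 'a \<Rightarrow>\<^sub>L 'a" and \<phi>'' :: "'a \<Rightarrow> 'a \<Rightarrow>\<^sub>L 'a \<Rightarrow>\<^sub>L 'a"
  assumes T: "subspace T" and U: "open U" and W: "open W"
    and d1: "\<And>x. x \<in> W \<Longrightarrow> (\<phi> has_derivative \<phi>' x) (at x)"
    and d2: "\<And>x. x \<in> W \<Longrightarrow> (\<phi>' has_derivative \<phi>'' x) (at x)"
    and cont: "continuous_on W \<phi>''"
    and perp: "\<And>x. x \<in> T \<inter> W \<Longrightarrow> \<phi> x \<in> T\<^sup>\<bottom>"
    and M: "M \<inter> U = {x + \<phi> x | x. x \<in> T \<inter> W}"
begin

abbreviation "P \<equiv> orth_proj T"

lemma bounded_linear_P: "bounded_linear P"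
  using linear_orth_proj[OF T] by (simp add: linear_conv_bounded_linear)

lemma P_in: "P y \<in> T"
  by (rule orth_proj_in[OF T])

lemma P_graph: "x \<in> T \<inter> W \<Longrightarrow> P (x + \<phi> x) = x"
  using orth_proj_id[OF T, of x] orth_proj_orthogonal[OF T perp, of x]
  by (simp add: linear_add[OF linear_orth_proj[OF T]])

lemma graph_decomp:
  assumes "y \<in> M \<inter> U" shows "P y \<in> T \<inter> W" "y = P y + \<phi> (P y)"
proof -
  obtain x where "x \<in> T \<inter> W" "y = x + \<phi> x" using assms unfolding M by blast
  then show "P y \<in> T \<inter> W" "y = P y + \<phi> (P y)" using P_graph[of x] by simp_all
qed

lemma graph_in: "x \<in> T \<inter> W \<Longrightarrow> x + \<phi> x \<in> M \<inter> U"
  unfolding M by blast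

lemma eventually_line:
  assumes "x \<in> T \<inter> W" "v \<in> T"
  shows "\<forall>\<^sub>F t in nhds (0::real). x + t *\<^sub>R v \<in> T \<inter> W"
proof -
  have "isCont (\<lambda>t::real. x + t *\<^sub>R v) 0" by (intro continuous_intros)
  then have "filterlim (\<lambda>t::real. x + t *\<^sub>R v) (nhds x) (nhds 0)"
    using tendsto_at_iff_tendsto_nhds[of "\<lambda>t::real. x + t *\<^sub>R v" 0] by (simp add: isCont_def)
  then have "\<forall>\<^sub>F t in nhds (0::real). x + t *\<^sub>R v \<in> W"
    using assms W by (intro topological_tendstoD) auto
  then show ?thesis
    by eventually_elim (use assms T in \<open>auto intro: subspace_add subspace_scale\<close>)
qed

lemma line_derivative:
  assumes "x + t *\<^sub>R v \<in> W"
  shows "((\<lambda>t. \<phi> (x + t *\<^sub>R v)) has_vector_derivative \<phi>' (x + t *\<^sub>R v) v) (at t)"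
    and "((\<lambda>t. \<phi>' (x + t *\<^sub>R v)) has_vector_derivative \<phi>'' (x + t *\<^sub>R v) v) (at t)"
proof -
  have l: "((\<lambda>t. x + t *\<^sub>R v) has_vector_derivative v) (at t)"
    by (auto intro!: derivative_eq_intros)
  show "((\<lambda>t. \<phi> (x + t *\<^sub>R v)) has_vector_derivative \<phi>' (x + t *\<^sub>R v) v) (at t)"
    by (rule has_vector_derivative_compose_at[OF l d1[OF assms] refl])
  show "((\<lambda>t. \<phi>' (x + t *\<^sub>R v)) has_vector_derivative \<phi>'' (x + t *\<^sub>R v) v) (at t)"
    by (rule has_vector_derivative_compose_at[OF l d2[OF assms] refl])
qed

text \<open>Differentiate \<open>inner s (\<phi> (x + t *\<^sub>R v)) = 0\<close> in
  \<open>t\<close>, for fixed \<open>s\<close> in \<open>T\<close>.\<close>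

lemma derivative_perp:
  assumes x: "x \<in> T \<inter> W" and v: "v \<in> T"
  shows "\<phi>' x v \<in> T\<^sup>\<bottom>"
proof -
  have "inner s (\<phi>' x v) = 0" if s: "s \<in> T" for s
  proof (rule has_vector_derivative_eventually_unique)
    have "((\<lambda>t. \<phi> (x + t *\<^sub>R v)) has_vector_derivative \<phi>' x v) (at 0)"
      using line_derivative(1)[of x 0 v] x by simp
    then show "((\<lambda>t. inner s (\<phi> (x + t *\<^sub>R v))) has_vector_derivative inner s (\<phi>' x v)) (at 0)"
      by (rule bounded_linear.has_vector_derivative[OF bounded_linear_inner_right])
    show "\<forall>\<^sub>F t in nhds 0. inner s (\<phi> (x + t *\<^sub>R v)) = 0"
      using eventually_line[OF x v]
      by eventually_elim (use perp s in \<open>auto simp: orthogonal_comp_def orthogonal_def\<close>)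
  qed simp
  then show ?thesis by (simp add: orthogonal_comp_def orthogonal_def)
qed

lemma P_tangent: "x \<in> T \<inter> W \<Longrightarrow> v \<in> T \<Longrightarrow> P (v + \<phi>' x v) = v"
  using orth_proj_id[OF T, of v] orth_proj_orthogonal[OF T derivative_perp, of x v]
  by (simp add: linear_add[OF linear_orth_proj[OF T]])

text \<open>Continuity keeps the curve in \<open>U\<close> near 0, so there it satisfies
  \<open>\<gamma> t = P (\<gamma> t) + \<phi> (P (\<gamma> t))\<close>; differentiate both
  sides.\<close>

lemma graph_curve_derivative:
  assumes \<gamma>: "(\<gamma> has_vector_derivative v) (at 0)" and x: "x \<in> T \<inter> W" "\<gamma> 0 = x + \<phi> x"
    and mem: "\<forall>\<^sub>F t in nhds 0. \<gamma> t \<in> M"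
  shows "v = P v + \<phi>' x (P v)"
proof (rule has_vector_derivative_eventually_unique[OF \<gamma>])
  let ?c = "\<lambda>t. P (\<gamma> t)"
  have c: "(?c has_vector_derivative P v) (at 0)"
    by (rule bounded_linear.has_vector_derivative[OF bounded_linear_P \<gamma>])
  have c0: "?c 0 = x" unfolding x(2) by (rule P_graph[OF x(1)])
  have "(\<phi> has_derivative \<phi>' x) (at x)" using x(1) by (intro d1) simp
  then have "((\<lambda>t. \<phi> (?c t)) has_vector_derivative \<phi>' x (P v)) (at 0)"
    by (rule has_vector_derivative_compose_at[OF c]) (rule c0)
  with c show "((\<lambda>t. ?c t + \<phi> (?c t)) has_vector_derivative P v + \<phi>' x (P v)) (at 0)"
    by (rule has_vector_derivative_add)
  have "isCont \<gamma> 0" using \<gamma> by (rule has_vector_derivative_continuous)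
  then have "filterlim \<gamma> (nhds (\<gamma> 0)) (nhds 0)"
    using tendsto_at_iff_tendsto_nhds[of \<gamma> 0] by (simp add: isCont_def)
  then have "\<forall>\<^sub>F t in nhds 0. \<gamma> t \<in> U"
    using graph_in x U by (intro topological_tendstoD) auto
  with mem show "\<forall>\<^sub>F t in nhds 0. \<gamma> t = ?c t + \<phi> (?c t)"
    by eventually_elim (use graph_decomp(2) in blast)
qed

text \<open>One inclusion is \<open>graph_curve_derivative\<close>; for the other, lift the line
  through \<open>x\<close> in direction \<open>v\<close> to the graph.\<close>

lemma tangent_space_graph:
  assumes x: "x \<in> T \<inter> W"
  shows "tangent_space M (x + \<phi> x) = (\<lambda>v. v + \<phi>' x v) ` T"
proof (intro set_eqI iffI)
  fix v assume "v \<in> tangent_space M (x + \<phi> x)"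
  then obtain \<gamma> e where \<gamma>: "e > 0" "\<gamma> ` {-e<..<e} \<subseteq> M" "\<gamma> 0 = x + \<phi> x" "(\<gamma> has_vector_derivative v) (at 0)"
    unfolding tangent_space_def by blast
  have "\<forall>\<^sub>F t in nhds 0. t \<in> {-e<..<e}" using \<gamma>(1) by (intro eventually_nhds_in_open) auto
  then have "\<forall>\<^sub>F t in nhds 0. \<gamma> t \<in> M" by eventually_elim (use \<gamma>(2) in blast)
  then have "v = P v + \<phi>' x (P v)" by (rule graph_curve_derivative[OF \<gamma>(4) x \<gamma>(3)])
  then show "v \<in> (\<lambda>v. v + \<phi>' x v) ` T" using P_in by blast
next
  fix w assume "w \<in> (\<lambda>v. v + \<phi>' x v) ` T"
  then obtain v where v: "v \<in> T" "w = v + \<phi>' x v" by blast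
  have "\<exists>e>0. \<forall>t. \<bar>t\<bar> < e \<longrightarrow> x + t *\<^sub>R v \<in> T \<inter> W"
    using eventually_line[OF x v(1)] unfolding eventually_nhds_metric dist_real_def by simp
  then obtain e where e: "e > 0" "\<And>t. \<bar>t\<bar> < e \<Longrightarrow> x + t *\<^sub>R v \<in> T \<inter> W"
    by blast
  let ?\<gamma> = "\<lambda>t::real. (x + t *\<^sub>R v) + \<phi> (x + t *\<^sub>R v)"
  have der: "(?\<gamma> has_vector_derivative v + \<phi>' (x + t *\<^sub>R v) v) (at t)" if "\<bar>t\<bar> < e" for t
    using e(2)[OF that] by (intro has_vector_derivative_add line_derivative) (auto intro!: derivative_eq_intros)
  have "continuous_on {-e<..<e} (\<lambda>t. v + \<phi>' (x + t *\<^sub>R v) v)"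
  proof (intro continuous_intros continuous_at_imp_continuous_on ballI)
    fix t assume "t \<in> {-e<..<e}"
    then have "x + t *\<^sub>R v \<in> W" using e(2)[of t] by auto
    then show "isCont (\<lambda>t. \<phi>' (x + t *\<^sub>R v)) t"
      by (rule has_vector_derivative_continuous[OF line_derivative(2)])
  qed
  then have "?\<gamma> C1_differentiable_on {-e<..<e}"
    unfolding C1_differentiable_on_def using der by (intro exI[of _ "\<lambda>t. v + \<phi>' (x + t *\<^sub>R v) v"]) (auto simp: abs_less_iff)
  moreover have "?\<gamma> ` {-e<..<e} \<subseteq> M"
    using e(2) graph_in by (auto simp: abs_less_iff)
  moreover have "(?\<gamma> has_vector_derivative w) (at 0)" using der[of 0] e(1) v(2) by simp
  ultimately show "w \<in> tangent_space M (x + \<phi> x)"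
    unfolding tangent_space_def using e(1) by (intro CollectI exI[of _ ?\<gamma>] exI[of _ e]) simp
qed

lemma linear_graph: "linear (\<lambda>v. v + \<phi>' x v)"
  by (intro linearI) (simp_all add: blinfun.add_right blinfun.scaleR_right scaleR_add_right)

lemma subspace_tangent_space: "x \<in> T \<inter> W \<Longrightarrow> subspace (tangent_space M (x + \<phi> x))"
  by (simp only: tangent_space_graph linear_subspace_image[OF linear_graph T])

lemma dim_tangent_space:
  assumes x: "x \<in> T \<inter> W"
  shows "dim (tangent_space M (x + \<phi> x)) = dim T"
  unfolding tangent_space_graph[OF x]
proof (rule dim_image_eq[OF linear_graph])
  have "span T = T" using T by (simp add: span_eq_iff)
  moreover have "inj_on (\<lambda>v. v + \<phi>' x v) T"
    by (rule inj_on_inverseI[where g = P]) (rule P_tangent[OF x])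
  ultimately show "inj_on (\<lambda>v. v + \<phi>' x v) (span T)" by (simp only:)
qed

lemma tangent_decomp:
  assumes x: "x \<in> T \<inter> W" and "v \<in> tangent_space M (x + \<phi> x)"
  shows "v = P v + \<phi>' x (P v)"
proof -
  obtain v' where v': "v' \<in> T" "v = v' + \<phi>' x v'"
    using assms(2) unfolding tangent_space_graph[OF x] by blast
  have "P v = v'" unfolding v'(2) by (rule P_tangent[OF x v'(1)])
  then show ?thesis using v'(2) by (simp only:)
qed

lemma tangent_in: "x \<in> T \<inter> W \<Longrightarrow> v \<in> T \<Longrightarrow> v + \<phi>' x v \<in> tangent_space M (x + \<phi> x)"
  using tangent_space_graph by blast

text \<open>Tangent vectors project to 0 in the normal space. This absorbs the freedom in choosing
  the tangent field in \<open>second_fundamental_form\<close>.\<close>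

lemma orth_proj_normal_cong:
  assumes "v - w \<in> tangent_space M z"
  shows "orth_proj (normal_space M z) v = orth_proj (normal_space M z) w"
proof -
  have s: "subspace (normal_space M z)" unfolding normal_space_def by (rule subspace_orthogonal_comp)
  have "v - w \<in> (normal_space M z)\<^sup>\<bottom>"
    using assms orthogonal_comp_subset unfolding normal_space_def by blast
  from orth_proj_orthogonal[OF s this] show ?thesis
    by (simp add: linear_diff[OF linear_orth_proj[OF s]])
qed

text \<open>An explicit field realises the value. For any other admissible field, differentiation
  along a curve with velocity \<open>u\<close> gives \<open>\<phi>'' x (P u) (P v)\<close> plus a
  tangent vector, which the normal projection removes; so the description is unique.\<close>

lemma second_fundamental_form_graph:
  assumes x: "x \<in> T \<inter> W" and u: "u \<in> tangent_space M (x + \<phi> x)" and v: "v \<in> tangent_space M (x + \<phi> x)"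
  shows "second_fundamental_form M (x + \<phi> x) u v =
    orth_proj (normal_space M (x + \<phi> x)) (\<phi>'' x (P u) (P v))"
  unfolding second_fundamental_form_def
proof (rule the_equality)
  let ?z = "x + \<phi> x"
  have contP: "continuous_on S P" for S
    using bounded_linear_P by (rule linear_continuous_on)
  \<comment> \<open>The field with constant parameter direction \<open>P v\<close>. Composing with
    \<open>P\<close> extends it from the graph to an open set of the ambient space.\<close>
  define V where "V y = P v + \<phi>' (P y) (P v)" for y
  define ev :: "('a \<Rightarrow>\<^sub>L 'a) \<Rightarrow>\<^sub>L 'a" where "ev = Blinfun (\<lambda>B. blinfun_apply B (P v))"
  define PT where "PT = Blinfun P"
  have ev: "blinfun_apply ev = (\<lambda>B. blinfun_apply B (P v))"
    unfolding ev_def by (intro bounded_linear_Blinfun_apply blinfun.bounded_linear_left)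
  have PT: "blinfun_apply PT = P"
    unfolding PT_def by (intro bounded_linear_Blinfun_apply bounded_linear_P)
  \<comment> \<open>Its derivative as a composition of bounded linear maps, so that continuity in
    operator norm follows from that of \<open>\<phi>''\<close>.\<close>
  define V' where "V' y = ev o\<^sub>L \<phi>'' (P y) o\<^sub>L PT" for y
  let ?U = "U \<inter> P -` W"
  have openU: "open ?U" using U open_vimage[OF W contP] by (rule open_Int)
  have zU: "?z \<in> ?U" using graph_in[OF x] P_graph[OF x] x by simp
  have der: "(V has_derivative blinfun_apply (V' y)) (at y)" if "y \<in> ?U" for y
  proof -
    have "P y \<in> W" using that by simp
    from has_derivative_compose[OF bounded_linear_imp_has_derivative[OF bounded_linear_P] d2[OF this]]
    have "((\<lambda>y. \<phi>' (P y)) has_derivative (\<lambda>h. \<phi>'' (P y) (P h))) (at y)" .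
    then have "((\<lambda>y. \<phi>' (P y) (P v)) has_derivative (\<lambda>h. \<phi>'' (P y) (P h) (P v))) (at y)"
      by (rule bounded_linear.has_derivative[OF blinfun.bounded_linear_left])
    from has_derivative_add[OF has_derivative_const this] show ?thesis
      unfolding V_def V'_def by (simp add: blinfun_compose.rep_eq ev PT o_def)
  qed
  have "continuous_on ?U V'"
    unfolding V'_def
    by (intro bounded_bilinear.continuous_on[OF bounded_bilinear_blinfun_compose] continuous_on_const
        continuous_on_compose2[OF cont contP]) auto
  then have "C1_on ?U V" unfolding C1_on_def using der by blast
  moreover have "V y \<in> tangent_space M y" if "y \<in> M \<inter> ?U" for y
  proof -
    have y: "y \<in> M \<inter> U" using that by blast
    have "V y \<in> tangent_space M (P y + \<phi> (P y))"
      unfolding V_def by (rule tangent_in[OF graph_decomp(1)[OF y] P_in])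
    then show ?thesis unfolding graph_decomp(2)[OF y, symmetric] .
  qed
  moreover have "V ?z = v" unfolding V_def P_graph[OF x] by (rule tangent_decomp[OF x v, symmetric])
  moreover have "frechet_derivative V (at ?z) u = \<phi>'' x (P u) (P v)"
    unfolding frechet_derivative_at[OF der[OF zU], symmetric]
    by (simp add: V'_def blinfun_compose.rep_eq ev PT P_graph[OF x])
  ultimately show "\<exists>U V. open U \<and> ?z \<in> U \<and> C1_on U V \<and> (\<forall>x\<in>M \<inter> U. V x \<in> tangent_space M x) \<and>
      V ?z = v \<and> orth_proj (normal_space M ?z) (\<phi>'' x (P u) (P v)) =
        orth_proj (normal_space M ?z) (frechet_derivative V (at ?z) u)"
    using openU zU by (intro exI[of _ ?U] exI[of _ V]) simp
next
  let ?z = "x + \<phi> x"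
  fix w
  assume "\<exists>U V. open U \<and> ?z \<in> U \<and> C1_on U V \<and> (\<forall>x\<in>M \<inter> U. V x \<in> tangent_space M x) \<and>
      V ?z = v \<and> w = orth_proj (normal_space M ?z) (frechet_derivative V (at ?z) u)"
  then obtain U' V where V: "open U'" "?z \<in> U'" "C1_on U' V"
      "\<And>y. y \<in> M \<inter> U' \<Longrightarrow> V y \<in> tangent_space M y" "V ?z = v"
    and w: "w = orth_proj (normal_space M ?z) (frechet_derivative V (at ?z) u)" by blast
  obtain D where D: "(V has_derivative blinfun_apply D) (at ?z)"
    using V(2,3) unfolding C1_on_def by blast
  \<comment> \<open>The lifted line through \<open>?z\<close> with velocity
    \<open>u\<close>.\<close>
  let ?y = "\<lambda>t::real. (x + t *\<^sub>R P u) + \<phi> (x + t *\<^sub>R P u)"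
  have x0: "x + 0 *\<^sub>R P u \<in> W" using x by simp
  have "(?y has_vector_derivative P u + \<phi>' (x + 0 *\<^sub>R P u) (P u)) (at 0)"
    by (intro has_vector_derivative_add line_derivative x0) (auto intro!: derivative_eq_intros)
  then have y: "(?y has_vector_derivative u) (at 0)"
    using tangent_decomp[OF x u] by simp
  have Vy: "((\<lambda>t. V (?y t)) has_vector_derivative D u) (at 0)"
    by (rule has_vector_derivative_compose_at[OF y D]) simp
  have a: "((\<lambda>t. P (V (?y t))) has_vector_derivative P (D u)) (at 0)"
    by (rule bounded_linear.has_vector_derivative[OF bounded_linear_P Vy])
  have "((\<lambda>t. \<phi>' (x + t *\<^sub>R P u) (P (V (?y t)))) has_vector_derivative
      \<phi>' (x + 0 *\<^sub>R P u) (P (D u)) + \<phi>'' (x + 0 *\<^sub>R P u) (P u) (P (V (?y 0)))) (at 0)"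
    by (rule bounded_bilinear.has_vector_derivative[OF bounded_bilinear_blinfun_apply line_derivative(2)[OF x0] a])
  from has_vector_derivative_add[OF a this]
  have rhs: "((\<lambda>t. P (V (?y t)) + \<phi>' (x + t *\<^sub>R P u) (P (V (?y t)))) has_vector_derivative
      P (D u) + (\<phi>' x (P (D u)) + \<phi>'' x (P u) (P v))) (at 0)"
    using V(5) by simp
  have "isCont ?y 0" using y by (rule has_vector_derivative_continuous)
  then have "filterlim ?y (nhds (?y 0)) (nhds 0)"
    using tendsto_at_iff_tendsto_nhds[of ?y 0] by (simp add: isCont_def)
  then have "\<forall>\<^sub>F t in nhds 0. ?y t \<in> U'"
    using V(1,2) by (intro topological_tendstoD) auto
  \<comment> \<open>On the graph the field is tangent, hence the lift of its own projection.
    Differentiating this identity with the product rule determines \<open>D u\<close> up to a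
    tangent vector.\<close>
  with eventually_line[OF x P_in[of u]]
  have "\<forall>\<^sub>F t in nhds 0. V (?y t) = P (V (?y t)) + \<phi>' (x + t *\<^sub>R P u) (P (V (?y t)))"
  proof eventually_elim
    case (elim t)
    then have "?y t \<in> M \<inter> U'" using graph_in by blast
    from tangent_decomp[OF elim(1) V(4)[OF this]] show ?case .
  qed
  from has_vector_derivative_eventually_unique[OF Vy rhs this]
  have "D u - \<phi>'' x (P u) (P v) = P (D u) + \<phi>' x (P (D u))" by (simp add: algebra_simps)
  then have "D u - \<phi>'' x (P u) (P v) \<in> tangent_space M ?z"
    using tangent_in[OF x P_in, of "D u"] by (simp only:)
  then show "w = orth_proj (normal_space M ?z) (\<phi>'' x (P u) (P v))"
    unfolding w frechet_derivative_at[OF D, symmetric] by (rule orth_proj_normal_cong)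
qed

text \<open>The formula for the second fundamental form extends to a bilinear map on the whole
  space, so its trace is independent of the basis; linearity moves the normal projection out of the
  sum.\<close>

lemma mean_curvature_graph:
  assumes x: "x \<in> T \<inter> W" and E: "orthonormal_basis_of (tangent_space M (x + \<phi> x)) E"
  shows "mean_curvature_vector k M (x + \<phi> x) =
    (1 / real k) *\<^sub>R orth_proj (normal_space M (x + \<phi> x)) (\<Sum>e\<in>E. \<phi>'' x (P e) (P e))"
proof -
  let ?z = "x + \<phi> x"
  let ?N = "orth_proj (normal_space M ?z)"
  have lin_N: "linear ?N"
    unfolding normal_space_def by (intro linear_orth_proj subspace_orthogonal_comp)
  have lin_P: "linear P" using T by (rule linear_orth_proj)
  define \<beta> where "\<beta> u v = ?N (\<phi>'' x (P u) (P v))" for u v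
  have lin1: "linear (\<lambda>u. \<beta> u v)" for v
    unfolding \<beta>_def
    by (intro linearI) (simp_all add: linear_add[OF lin_P] linear_scale[OF lin_P] blinfun.bilinear_simps
        linear_add[OF lin_N] linear_scale[OF lin_N])
  have lin2: "linear (\<beta> u)" for u
    unfolding \<beta>_def
    by (intro linearI) (simp_all add: linear_add[OF lin_P] linear_scale[OF lin_P] blinfun.bilinear_simps
        linear_add[OF lin_N] linear_scale[OF lin_N])
  have sff: "(\<Sum>e\<in>F. second_fundamental_form M ?z e e) = (\<Sum>e\<in>F. \<beta> e e)"
    if F: "orthonormal_basis_of (tangent_space M ?z) F" for F
    unfolding \<beta>_def using orthonormal_basis_of_props(6)[OF F]
    by (intro sum.cong refl second_fundamental_form_graph x) blast+
  have "(THE s. \<exists>E. orthonormal_basis_of (tangent_space M ?z) E \<and>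
      s = (\<Sum>e\<in>E. second_fundamental_form M ?z e e)) = (\<Sum>e\<in>E. \<beta> e e)"
  proof (rule the_equality)
    show "\<exists>F. orthonormal_basis_of (tangent_space M ?z) F \<and> (\<Sum>e\<in>E. \<beta> e e) = (\<Sum>e\<in>F. second_fundamental_form M ?z e e)"
      using E sff[OF E] by (intro exI[of _ E]) simp
    fix s assume "\<exists>F. orthonormal_basis_of (tangent_space M ?z) F \<and> s = (\<Sum>e\<in>F. second_fundamental_form M ?z e e)"
    then obtain F where F: "orthonormal_basis_of (tangent_space M ?z) F" and s: "s = (\<Sum>e\<in>F. second_fundamental_form M ?z e e)"
      by blast
    show "s = (\<Sum>e\<in>E. \<beta> e e)"
      unfolding s sff[OF F] by (rule trace_orthonormal_basis_unique[OF F E lin1 lin2])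
  qed
  also have "(\<Sum>e\<in>E. \<beta> e e) = ?N (\<Sum>e\<in>E. \<phi>'' x (P e) (P e))"
    unfolding \<beta>_def by (rule linear_sum[OF lin_N, symmetric])
  finally show ?thesis unfolding mean_curvature_vector_def by (simp only:)
qed

text \<open>Supplies the curves for \<open>msupport_subset_plane\<close> by lifting the line in
  direction \<open>P u\<close>. Its component in \<open>T\<close> is affine in \<open>t\<close>, so
  the whole acceleration is the second derivative of \<open>\<phi>\<close> along the line.\<close>

lemma graph_curve_second_order:
  assumes x: "x \<in> T \<inter> W" and u: "u \<in> tangent_space M (x + \<phi> x)"
  obtains r where "(r \<longlongrightarrow> \<phi>'' x (P u) (P u)) (at (0::real))"
    "\<forall>\<^sub>F t in at 0. (x + \<phi> x) + (t *\<^sub>R u + (t\<^sup>2 / 2) *\<^sub>R r t) \<in> M"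
proof -
  let ?g = "\<lambda>t::real. \<phi> (x + t *\<^sub>R P u)" and ?g' = "\<lambda>t::real. \<phi>' (x + t *\<^sub>R P u) (P u)"
  \<comment> \<open>The rescaled Taylor remainder of \<open>\<phi>\<close> along the line, chosen so
    that the lifted curve has the required form exactly for small
    \<open>t \<noteq> 0\<close>.\<close>
  define r where "r t = (2 / t\<^sup>2) *\<^sub>R (?g t - ?g 0 - t *\<^sub>R ?g' 0)" for t
  have line: "\<forall>\<^sub>F t in nhds 0. x + t *\<^sub>R P u \<in> T \<inter> W" by (rule eventually_line[OF x P_in])
  then have "\<exists>e>0. \<forall>t. \<bar>t\<bar> < e \<longrightarrow> x + t *\<^sub>R P u \<in> T \<inter> W"
    unfolding eventually_nhds_metric dist_real_def by simp
  then obtain e where e: "e > 0" "\<And>t. \<bar>t\<bar> < e \<Longrightarrow> x + t *\<^sub>R P u \<in> W" by blast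
  have x0: "x + 0 *\<^sub>R P u \<in> W" using x by simp
  have "(?g' has_vector_derivative \<phi>'' (x + 0 *\<^sub>R P u) (P u) (P u)) (at 0)"
    by (rule bounded_linear.has_vector_derivative[OF blinfun.bounded_linear_left line_derivative(2)[OF x0]])
  then have "(?g' has_vector_derivative \<phi>'' x (P u) (P u)) (at 0)" by simp
  from second_order_expansion[OF e(1) line_derivative(1)[OF e(2)] this]
  have "(r \<longlongrightarrow> \<phi>'' x (P u) (P u)) (at 0)" unfolding r_def .
  moreover have "\<forall>\<^sub>F t in at 0. (x + \<phi> x) + (t *\<^sub>R u + (t\<^sup>2 / 2) *\<^sub>R r t) \<in> M"
    using filter_leD[OF at_within_le_nhds line] eventually_neq_at_within[of 0 0 UNIV]
  proof eventually_elim
    case (elim t)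
    have "(t\<^sup>2 / 2) *\<^sub>R r t = ?g t - \<phi> x - t *\<^sub>R \<phi>' x (P u)"
      using elim(2) by (simp add: r_def)
    moreover have "t *\<^sub>R u = t *\<^sub>R P u + t *\<^sub>R \<phi>' x (P u)"
      using tangent_decomp[OF x u] by (metis scaleR_add_right)
    ultimately have eq: "(x + \<phi> x) + (t *\<^sub>R u + (t\<^sup>2 / 2) *\<^sub>R r t) = (x + t *\<^sub>R P u) + ?g t"
      by (simp only:) (simp add: algebra_simps)
    show ?case unfolding eq using graph_in[OF elim(1)] by blast
  qed
  ultimately show thesis by (rule that)
qed

end

section \<open>From vanishing mean curvature to a flat component\<close>

theorem theorem1p1:
  fixes \<mu> :: "'a::euclidean_space measure" and n k :: nat and z0 :: 'a
  assumes "DIM('a) = n + 1"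
    and "k \<le> n + 1"
    and "locally_uniform k \<mu>"
    and "z0 \<in> msupport \<mu>"
    and "C2_submanifold_near k (msupport \<mu>) z0"
    and "mean_curvature_vector k (msupport \<mu>) z0 = 0"
  shows "k_plane k (connected_component_set (msupport \<mu>) z0)"
proof -
  let ?M = "msupport \<mu>"
  obtain T U W \<phi> where sub_T: "subspace T" and dim_T: "dim T = k" and open_U: "open U" and z0_U: "z0 \<in> U" and open_W: "open W"
    and C2: "C2_on W \<phi>" and normal: "\<And>x. x \<in> T \<inter> W \<Longrightarrow> \<phi> x \<in> T\<^sup>\<bottom>"
    and graph: "?M \<inter> U = {x + \<phi> x | x. x \<in> T \<inter> W}"
    using assms(5) unfolding C2_submanifold_near_def by blast
  obtain \<phi>' \<phi>'' where d: "\<And>x. x \<in> W \<Longrightarrow> (\<phi> has_derivative blinfun_apply (\<phi>' x)) (at x)"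
      "\<And>x. x \<in> W \<Longrightarrow> (\<phi>' has_derivative blinfun_apply (\<phi>'' x)) (at x)" "continuous_on W \<phi>''"
    using C2 unfolding C2_on_def C1_on_def by blast
  interpret C2_graph T U W ?M \<phi> \<phi>' \<phi>''
    by unfold_locales (fact sub_T open_U open_W d normal graph)+
  define x where "x = P z0"
  have z0: "z0 \<in> ?M \<inter> U" using assms(4) z0_U by blast
  have x: "x \<in> T \<inter> W" and z0_eq: "z0 = x + \<phi> x"
    unfolding x_def by (fact graph_decomp[OF z0])+
  let ?\<tau> = "tangent_space ?M (x + \<phi> x)"
  obtain E where "E \<subseteq> ?\<tau>" "pairwise orthogonal E" "\<And>e. e \<in> E \<Longrightarrow> norm e = 1" "span E = ?\<tau>"
    using orthonormal_basis_subspace[OF subspace_tangent_space[OF x]] by metis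
  then have onb: "orthonormal_basis_of ?\<tau> E" by (simp add: orthonormal_basis_of_def)
  note E = orthonormal_basis_of_props[OF onb]
  have card: "card E = k" unfolding E(2) dim_tangent_space[OF x] by (rule dim_T)
  define w where "w e = \<phi>'' x (P e) (P e)" for e
  let ?N = "normal_space ?M (x + \<phi> x)"
  have N: "subspace ?N" unfolding normal_space_def by (rule subspace_orthogonal_comp)
  have "(1 / real k) *\<^sub>R orth_proj ?N (\<Sum>e\<in>E. w e) = 0"
    using assms(6) unfolding z0_eq mean_curvature_graph[OF x onb] w_def .
  \<comment> \<open>For \<open>k = 0\<close> the factor \<open>1 / real k\<close> is 0 and cannot be
    cancelled, but then \<open>E\<close> is empty and the sum itself is 0.\<close>
  then have H: "(\<Sum>e\<in>E. w e) = 0 \<or> orth_proj ?N (\<Sum>e\<in>E. w e) = 0"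
    using card E(1) by (cases "k = 0") auto
  \<comment> \<open>Zero normal projection makes the sum of the accelerations orthogonal to the
    normal space, and \<open>b\<close>, being orthogonal to the basis \<open>E\<close> of the
    tangent space, is normal.\<close>
  have orth: "inner (\<Sum>e\<in>E. w e) b = 0" if b: "\<And>e. e \<in> E \<Longrightarrow> inner e b = 0" for b
    using H
  proof
    assume H0: "orth_proj ?N (\<Sum>e\<in>E. w e) = 0"
    have "orthogonal y b" if "y \<in> ?\<tau>" for y
    proof -
      have "y \<in> span E" using that E(5) by simp
      moreover have "\<And>e. e \<in> E \<Longrightarrow> orthogonal b e" using b by (simp add: orthogonal_def inner_commute)
      ultimately have "orthogonal b y" by (rule orthogonal_to_span)
      then show ?thesis by (simp add: orthogonal_commute)
    qed
    then have "b \<in> ?N" by (simp add: normal_space_def orthogonal_comp_def)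
    moreover have "(\<Sum>e\<in>E. w e) \<in> ?N\<^sup>\<bottom>"
      using orth_proj_diff[OF N, of "\<Sum>e\<in>E. w e"] H0 by simp
    ultimately show ?thesis by (simp add: orthogonal_comp_def orthogonal_def inner_commute)
  qed simp
  have "\<forall>e\<in>E. \<exists>r. (r \<longlongrightarrow> w e) (at (0::real)) \<and>
      (\<forall>\<^sub>F t in at 0. z0 + (t *\<^sub>R e + (t\<^sup>2 / 2) *\<^sub>R r t) \<in> ?M)"
  proof
    fix e assume "e \<in> E"
    then have "e \<in> ?\<tau>" using E(6) by blast
    from graph_curve_second_order[OF x this] obtain r where
      "(r \<longlongrightarrow> \<phi>'' x (P e) (P e)) (at (0::real))"
      "\<forall>\<^sub>F t in at 0. (x + \<phi> x) + (t *\<^sub>R e + (t\<^sup>2 / 2) *\<^sub>R r t) \<in> ?M" .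
    then show "\<exists>r. (r \<longlongrightarrow> w e) (at (0::real)) \<and>
        (\<forall>\<^sub>F t in at 0. z0 + (t *\<^sub>R e + (t\<^sup>2 / 2) *\<^sub>R r t) \<in> ?M)"
      unfolding w_def z0_eq by blast
  qed
  from bchoice[OF this] obtain r where r: "\<And>e. e \<in> E \<Longrightarrow> (r e \<longlongrightarrow> w e) (at (0::real))"
    "\<And>e. e \<in> E \<Longrightarrow> \<forall>\<^sub>F t in at 0. z0 + (t *\<^sub>R e + (t\<^sup>2 / 2) *\<^sub>R r e t) \<in> ?M"
    by blast
  have sub: "?M \<inter> ball z0 1 \<subseteq> (+) z0 ` span E"
    by (rule msupport_subset_plane[OF assms(3,4) E(1,3,4) card r orth])
  then have flat: "?M \<inter> ball z0 1 = (+) z0 ` span E \<inter> ball z0 1"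
    using msupport_contains_plane_ball[OF assms(3,4) E(1,3,4) card sub] by blast
  show ?thesis by (rule flat_component[OF assms(3,4) E(1,3,4) card flat])
qed

end
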